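(* The facial weak order on $\mathcal P_W$ is a lattice. For standard parabolic cosets $xW_I$ and $yW_J$ ($x\in W^I$, $y\in W^J$), the meet is $xW_I\wedge yW_J=z_\wedge W_{K_\wedge}$ where $z_\wedge=x\wedge y$ and $K_\wedge=D_L\big(z_\wedge^{-1}(xw_{\circ,I}\wedge yw_{\circ,J})\big)$, and the join is the coset $xW_I\vee yW_J=z_\vee W_{K_\vee}$ (as a set; $z_\vee$ is its maximal element), where $z_\vee=xw_{\circ,I}\vee yw_{\circ,J}$ and $K_\vee=D_L\big(z_\vee^{-1}(x\vee y)\big)$. Here $\wedge,\vee$ on elements of $W$ denote meet and join in the weak order.
   Context: $(W,S)$ is a finite Coxeter system with length function $\ell$. For $I\subseteq S$, $W_I$ is the subgroup generated by $I$, $w_{\circ,I}$ its longest element, and $W^I=\{w\in W:\ell(ws)>\ell(w)\ \forall s\in I\}$. The (right) weak order on $W$ is $u\le v$ iff $\ell(u)+\ell(u^{-1}v)=\ell(v)$; it is a lattice. $D_L(w)=\{s\in S:\ell(sw)<\ell(w)\}$ is the left descent set. A standard parabolic coset is $xW_I$ with $I\subseteq S$, written with $x\in W^I$; $\mathcal P_W$ is the set of all of them. The facial weak order on $\mathcal P_W$ is the reflexive-transitive closure of the relations (for $x\in W^I$): (1) $xW_I\lessdot xW_{I\cup\{s\}}$ if $s\notin I$ and $x\in W^{I\cup\{s\}}$; (2) $xW_I\lessdot xw_{\circ,I}w_{\circ,I\setminus\{s\}}W_{I\setminus\{s\}}$ if $s\in I$. *)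

theory Defs
  imports "HOL-Algebra.Lattice" "HOL-Algebra.Coset" "HOL-Algebra.Generated_Groups"
begin

definition word_prod :: "('a, 'b) monoid_scheme \<Rightarrow> 'a list \<Rightarrow> 'a" where
  "word_prod G ws = foldr (\<lambda>s w. s \<otimes>\<^bsub>G\<^esub> w) ws \<one>\<^bsub>G\<^esub>"

text \<open>A Coxeter matrix on \<open>S\<close>; the entry \<open>0\<close> encodes \<open>m s t = \<infinity>\<close>.\<close>

definition coxeter_matrix :: "'a set \<Rightarrow> ('a \<Rightarrow> 'a \<Rightarrow> nat) \<Rightarrow> bool" where
  "coxeter_matrix S m \<longleftrightarrow>
     (\<forall>s\<in>S. \<forall>t\<in>S. m s t = m t s \<and> (m s t = 1 \<longleftrightarrow> s = t))"

text \<open>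
  The congruence on words over \<open>S\<close> generated by \<open>(s t)\<^bsup>m s t\<^esup> = 1\<close>. Since \<open>m s s = 1\<close>, every
  letter is its own inverse modulo this congruence, so the monoid presented in this way is the
  group with generators \<open>S\<close> and the same relations. For \<open>m s t = 0\<close> the relation is trivial.
\<close>

inductive coxeter_cong :: "'a set \<Rightarrow> ('a \<Rightarrow> 'a \<Rightarrow> nat) \<Rightarrow> 'a list \<Rightarrow> 'a list \<Rightarrow> bool"
  for S m where
  rel: "\<lbrakk>s \<in> S; t \<in> S; set us \<subseteq> S; set vs \<subseteq> S\<rbrakk> \<Longrightarrow>
      coxeter_cong S m (us @ concat (replicate (m s t) [s, t]) @ vs) (us @ vs)"
| refl: "set us \<subseteq> S \<Longrightarrow> coxeter_cong S m us us"
| sym: "coxeter_cong S m us vs \<Longrightarrow> coxeter_cong S m vs us"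
| trans: "\<lbrakk>coxeter_cong S m us vs; coxeter_cong S m vs ws\<rbrakk> \<Longrightarrow> coxeter_cong S m us ws"

text \<open>\<open>G\<close> is the group presented by \<open>\<langle>S | (s t)\<^bsup>m s t\<^esup> = 1\<rangle>\<close> for some Coxeter matrix \<open>m\<close>.\<close>

definition coxeter_system :: "('a, 'b) monoid_scheme \<Rightarrow> 'a set \<Rightarrow> bool" where
  "coxeter_system G S \<longleftrightarrow>
     group G \<and> S \<subseteq> carrier G \<and> generate G S = carrier G \<and>
     (\<exists>m. coxeter_matrix S m \<and>
       (\<forall>us vs. set us \<subseteq> S \<longrightarrow> set vs \<subseteq> S \<longrightarrow>
          (word_prod G us = word_prod G vs \<longleftrightarrow> coxeter_cong S m us vs)))"

definition cox_length :: "('a, 'b) monoid_scheme \<Rightarrow> 'a set \<Rightarrow> 'a \<Rightarrow> nat" where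
  "cox_length G S w = (LEAST n. \<exists>ws. set ws \<subseteq> S \<and> length ws = n \<and> word_prod G ws = w)"

definition longest_elem :: "('a, 'b) monoid_scheme \<Rightarrow> 'a set \<Rightarrow> 'a set \<Rightarrow> 'a" where
  "longest_elem G S I =
     (THE w. w \<in> generate G I \<and> (\<forall>v\<in>generate G I. cox_length G S v \<le> cox_length G S w))"

text \<open>The set \<open>W\<^sup>I\<close> of minimal length representatives of the left cosets of \<open>W\<^sub>I\<close>.\<close>

definition min_reps :: "('a, 'b) monoid_scheme \<Rightarrow> 'a set \<Rightarrow> 'a set \<Rightarrow> 'a set" where
  "min_reps G S I =
     {w \<in> carrier G. \<forall>s\<in>I. cox_length G S (w \<otimes>\<^bsub>G\<^esub> s) > cox_length G S w}"

definition left_descents :: "('a, 'b) monoid_scheme \<Rightarrow> 'a set \<Rightarrow> 'a \<Rightarrow> 'a set" where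
  "left_descents G S w = {s \<in> S. cox_length G S (s \<otimes>\<^bsub>G\<^esub> w) < cox_length G S w}"

definition weak_order :: "('a, 'b) monoid_scheme \<Rightarrow> 'a set \<Rightarrow> 'a gorder" where
  "weak_order G S =
     \<lparr>carrier = carrier G, eq = (=),
      le = (\<lambda>u v. cox_length G S u + cox_length G S (inv\<^bsub>G\<^esub> u \<otimes>\<^bsub>G\<^esub> v) = cox_length G S v)\<rparr>"

definition parabolic_cosets :: "('a, 'b) monoid_scheme \<Rightarrow> 'a set \<Rightarrow> 'a set set" where
  "parabolic_cosets G S = {x <#\<^bsub>G\<^esub> generate G I | x I. x \<in> carrier G \<and> I \<subseteq> S}"

inductive facial_cover :: "('a, 'b) monoid_scheme \<Rightarrow> 'a set \<Rightarrow> 'a set \<Rightarrow> 'a set \<Rightarrow> bool"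
  for G S where
  up: "\<lbrakk>I \<subseteq> S; x \<in> min_reps G S I; s \<in> S; s \<notin> I; x \<in> min_reps G S (I \<union> {s})\<rbrakk> \<Longrightarrow>
      facial_cover G S (x <#\<^bsub>G\<^esub> generate G I) (x <#\<^bsub>G\<^esub> generate G (I \<union> {s}))"
| down: "\<lbrakk>I \<subseteq> S; x \<in> min_reps G S I; s \<in> I\<rbrakk> \<Longrightarrow>
      facial_cover G S (x <#\<^bsub>G\<^esub> generate G I)
        ((x \<otimes>\<^bsub>G\<^esub> longest_elem G S I \<otimes>\<^bsub>G\<^esub> longest_elem G S (I - {s}))
           <#\<^bsub>G\<^esub> generate G (I - {s}))"

definition facial_weak_order :: "('a, 'b) monoid_scheme \<Rightarrow> 'a set \<Rightarrow> 'a set gorder" where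
  "facial_weak_order G S =
     \<lparr>carrier = parabolic_cosets G S, eq = (=), le = (facial_cover G S)\<^sup>*\<^sup>*\<rparr>"

end

theory Submission
  imports Defs
begin

text \<open>
  Write \<open>N(w)\<close> for the set of reflections \<open>t\<close> with \<open>\<ell>(t w) < \<ell>(w)\<close>. The presentation yields the
  cocycle rule \<open>N(u v) = N(u) \<triangle> u N(v) u\<^sup>-\<^sup>1\<close>, so that \<open>\<ell>(w) = |N(w)|\<close> and the weak order is
  inclusion of inversion sets. It is a lattice because two covers \<open>z s\<close>, \<open>z t\<close> of \<open>z\<close> have the join
  \<open>z w\<^sub>\<circ>\<^sub>,\<^sub>{\<^sub>s\<^sub>,\<^sub>t\<^sub>}\<close>, which suffices in a finite poset with a least and a greatest element.

  The facial weak order compares cosets by their minima and by their maxima. To see this, and to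
  identify the meet of \<open>x W\<^sub>I\<close> and \<open>y W\<^sub>J\<close>, start from a common lower bound \<open>u W\<^sub>L\<close> with
  \<open>u < x \<and> y\<close>, choose \<open>s\<close> with \<open>u < u s \<le> x \<and> y\<close>, and climb one cover: to \<open>u W\<^sub>L\<^sub>\<union>\<^sub>{\<^sub>s\<^sub>}\<close> if
  \<open>s \<notin> L\<close>, and otherwise to the upper facet of \<open>u W\<^sub>L\<close> obtained by removing \<open>r = w\<^sub>\<circ>\<^sub>,\<^sub>L s w\<^sub>\<circ>\<^sub>,\<^sub>L\<close>.
  The result is again a common lower bound, so the climb ends at a coset with minimum \<open>x \<and> y\<close>.
  Left multiplication by \<open>w\<^sub>\<circ>\<close> reverses both orders and turns meets into joins.
\<close>

section \<open>Conjugation in groups, symmetric differences, uniqueness of meets and joins\<close>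

context group
begin

lemma inv_mult_cancel_left [simp]:
  "x \<in> carrier G \<Longrightarrow> y \<in> carrier G \<Longrightarrow> inv x \<otimes> (x \<otimes> y) = y"
  by (simp flip: m_assoc)

lemma mult_inv_cancel_left [simp]:
  "x \<in> carrier G \<Longrightarrow> y \<in> carrier G \<Longrightarrow> x \<otimes> (inv x \<otimes> y) = y"
  by (simp flip: m_assoc)

text \<open>Conjugation by \<open>g\<close> is a homomorphism and undoes the conjugation of the
  generators. This moves membership between parabolic subgroups with conjugate generators.\<close>

lemma generate_conj:
  assumes "X \<subseteq> carrier G" "g \<in> carrier G" "u \<in> generate G ((\<lambda>l. inv g \<otimes> l \<otimes> g) ` X)"
  shows "g \<otimes> u \<otimes> inv g \<in> generate G X"
  using assms(3)
proof (induction rule: generate.induct)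
  case one
  then show ?case
    using assms by (simp add: generate.one)
next
  case (incl h)
  then obtain l where "l \<in> X" "h = inv g \<otimes> l \<otimes> g"
    by blast
  moreover from this have "l \<in> carrier G"
    using assms by blast
  ultimately show ?case
    using assms by (simp add: m_assoc generate.incl)
next
  case (inv h)
  then obtain l where "l \<in> X" "h = inv g \<otimes> l \<otimes> g"
    by blast
  moreover from this have "l \<in> carrier G"
    using assms by blast
  ultimately show ?case
    using assms by (simp add: m_assoc inv_mult_group generate.inv)
next
  case (eng h1 h2)
  have "(\<lambda>l. inv g \<otimes> l \<otimes> g) ` X \<subseteq> carrier G"
    using assms by auto
  then have "h1 \<in> carrier G" "h2 \<in> carrier G"
    using eng.hyps generate_in_carrier by blast+
  then have "g \<otimes> (h1 \<otimes> h2) \<otimes> inv g = (g \<otimes> h1 \<otimes> inv g) \<otimes> (g \<otimes> h2 \<otimes> inv g)"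
    using assms by (simp add: m_assoc)
  then show ?case
    using eng.IH generate.eng by metis
qed

end

text \<open>Inversion sets of products are symmetric differences; this count turns them into a
  formula for lengths.\<close>

lemma card_sym_diff:
  assumes "finite A" "finite B"
  shows "card ((A - B) \<union> (B - A)) + 2 * card (A \<inter> B) = card A + card B"
proof -
  have "card A = card (A - B) + card (A \<inter> B)"
    using assms card_Int_Diff[of A B] by simp
  moreover have "card B = card (B - A) + card (A \<inter> B)"
    using assms card_Int_Diff[of B A] by (simp add: Int_commute)
  moreover have "card ((A - B) \<union> (B - A)) = card (A - B) + card (B - A)"
    using assms by (intro card_Un_disjoint) auto
  ultimately show ?thesis by simp
qed

text \<open>The meet is a Hilbert choice among greatest lower bounds, and antisymmetry leaves only
  one candidate.\<close>

lemma (in partial_order) meet_equality: "greatest L m (Lower L {x, y}) \<Longrightarrow> x \<sqinter> y = m"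
  unfolding meet_def inf_def by (rule some_equality) (auto intro: greatest_unique)

lemma (in partial_order) join_equality: "least L m (Upper L {x, y}) \<Longrightarrow> x \<squnion> y = m"
  unfolding join_def sup_def by (rule some_equality) (auto intro: least_unique)

section \<open>Words, length and parity in a Coxeter system\<close>

locale coxeter = group W for W (structure) +
  fixes S :: "'a set" and m :: "'a \<Rightarrow> 'a \<Rightarrow> nat"
  assumes S_subset: "S \<subseteq> carrier W"
    and generate_S: "generate W S = carrier W"
    and matrix: "coxeter_matrix S m"
    and presentation: "set us \<subseteq> S \<Longrightarrow> set vs \<subseteq> S \<Longrightarrow>
      word_prod W us = word_prod W vs \<longleftrightarrow> coxeter_cong S m us vs"
begin

abbreviation len :: "'a \<Rightarrow> nat" where
  "len \<equiv> cox_length W S"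

definition wle :: "'a \<Rightarrow> 'a \<Rightarrow> bool" (infix \<open>\<preceq>\<close> 50) where
  "u \<preceq> v \<longleftrightarrow> len u + len (inv u \<otimes> v) = len v"

abbreviation parab :: "'a set \<Rightarrow> 'a set" where
  "parab I \<equiv> generate W I"

lemma S_carrier [simp]: "s \<in> S \<Longrightarrow> s \<in> carrier W"
  using S_subset by auto

lemma word_prod_Nil [simp]: "word_prod W [] = \<one>"
  by (simp add: word_prod_def)

lemma word_prod_Cons [simp]: "word_prod W (s # ws) = s \<otimes> word_prod W ws"
  by (simp add: word_prod_def)

lemma word_prod_closed [simp]: "set ws \<subseteq> S \<Longrightarrow> word_prod W ws \<in> carrier W"
  by (induction ws) auto

lemma word_prod_append:
  "set us \<subseteq> S \<Longrightarrow> set vs \<subseteq> S \<Longrightarrow> word_prod W (us @ vs) = word_prod W us \<otimes> word_prod W vs"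
  by (induction us) (auto simp: m_assoc)

lemma S_square [simp]: "s \<in> S \<Longrightarrow> s \<otimes> s = \<one>"
proof -
  assume s: "s \<in> S"
  then have "m s s = 1"
    using matrix by (auto simp: coxeter_matrix_def)
  then have "coxeter_cong S m [s, s] []"
    using coxeter_cong.rel[of s S s "[]" "[]" m] s by simp
  then show ?thesis
    using presentation[of "[s, s]" "[]"] s by simp
qed

lemma S_inv [simp]: "s \<in> S \<Longrightarrow> inv s = s"
  by (rule inv_equality) auto

lemma S_cancel [simp]: "s \<in> S \<Longrightarrow> x \<in> carrier W \<Longrightarrow> s \<otimes> (s \<otimes> x) = x"
  by (simp flip: m_assoc)

lemma S_cancel_right [simp]: "s \<in> S \<Longrightarrow> x \<in> carrier W \<Longrightarrow> x \<otimes> s \<otimes> s = x"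
  by (simp add: m_assoc)

lemma word_prod_rev: "set ws \<subseteq> S \<Longrightarrow> word_prod W (rev ws) = inv (word_prod W ws)"
  by (induction ws) (auto simp: word_prod_append inv_mult_group)

text \<open>A relator has the even length \<open>2 * m s t\<close>, so the sign of a group element
  is well defined.\<close>

lemma cong_length_parity:
  "coxeter_cong S m us vs \<Longrightarrow> even (length us) \<longleftrightarrow> even (length vs)"
  by (induction rule: coxeter_cong.induct) (auto simp: length_concat sum_list_replicate)

lemma generate_word:
  assumes "I \<subseteq> S" "w \<in> parab I"
  obtains ws where "set ws \<subseteq> I" "word_prod W ws = w"
proof -
  have "\<exists>ws. set ws \<subseteq> I \<and> word_prod W ws = w"
    using assms(2)
  proof (induction rule: generate.induct)
    case one
    show ?case by (rule exI[of _ "[]"]) simp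
  next
    case (incl h)
    with assms(1) show ?case by (intro exI[of _ "[h]"]) auto
  next
    case (inv h)
    with assms(1) show ?case by (intro exI[of _ "[h]"]) auto
  next
    case (eng h1 h2)
    then obtain us vs where "set us \<subseteq> I" "word_prod W us = h1" "set vs \<subseteq> I" "word_prod W vs = h2"
      by blast
    with assms(1) show ?case
      by (intro exI[of _ "us @ vs"]) (auto simp: word_prod_append)
  qed
  with that show thesis by blast
qed

lemma len_le_length: "set ws \<subseteq> S \<Longrightarrow> len (word_prod W ws) \<le> length ws"
  unfolding cox_length_def by (rule Least_le) auto

lemma reduced_word:
  assumes "w \<in> carrier W"
  obtains ws where "set ws \<subseteq> S" "word_prod W ws = w" "length ws = len w"
proof -
  have "\<exists>n ws. set ws \<subseteq> S \<and> length ws = n \<and> word_prod W ws = w"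
    using generate_word[of S w] assms generate_S by auto
  then have "\<exists>ws. set ws \<subseteq> S \<and> length ws = len w \<and> word_prod W ws = w"
    unfolding cox_length_def by (rule LeastI_ex)
  with that show thesis by blast
qed

lemma len_one [simp]: "len \<one> = 0"
  using len_le_length[of "[]"] by simp

lemma len_zero_iff: "w \<in> carrier W \<Longrightarrow> len w = 0 \<longleftrightarrow> w = \<one>"
  by (metis reduced_word length_0_conv word_prod_Nil len_one)

lemma len_mult_le:
  assumes "u \<in> carrier W" "v \<in> carrier W"
  shows "len (u \<otimes> v) \<le> len u + len v"
proof -
  obtain us vs where "set us \<subseteq> S" "word_prod W us = u" "length us = len u"
    "set vs \<subseteq> S" "word_prod W vs = v" "length vs = len v"
    using assms reduced_word by metis
  then show ?thesis
    using len_le_length[of "us @ vs"] by (auto simp: word_prod_append)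
qed

lemma len_inv [simp]: "w \<in> carrier W \<Longrightarrow> len (inv w) = len w"
proof -
  have *: "len (inv w) \<le> len w" if w: "w \<in> carrier W" for w
    using w by (metis reduced_word word_prod_rev len_le_length length_rev set_rev)
  assume "w \<in> carrier W"
  then show ?thesis
    using *[of w] *[of "inv w"] by simp
qed

lemma len_parity:
  assumes "set ws \<subseteq> S"
  shows "even (len (word_prod W ws)) \<longleftrightarrow> even (length ws)"
proof -
  obtain vs where "set vs \<subseteq> S" "word_prod W vs = word_prod W ws" "length vs = len (word_prod W ws)"
    using assms reduced_word word_prod_closed by metis
  then show ?thesis
    using assms presentation cong_length_parity by metis
qed

text \<open>The triangle inequality bounds the change of length by one, and parity excludes
  equality.\<close>

lemma len_S_mult_cases:
  assumes "s \<in> S" "w \<in> carrier W"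
  shows "len (s \<otimes> w) = len w + 1 \<or> len w = len (s \<otimes> w) + 1"
proof -
  obtain ws where ws: "set ws \<subseteq> S" "word_prod W ws = w" "length ws = len w"
    using assms reduced_word by metis
  have "len (s \<otimes> w) \<noteq> len w"
    using len_parity[of "s # ws"] ws assms by auto
  moreover have "len s \<le> 1"
    using len_le_length[of "[s]"] assms by simp
  moreover have "len w \<le> len s + len (s \<otimes> w)"
    using len_mult_le[of s "s \<otimes> w"] assms by simp
  ultimately show ?thesis
    using len_mult_le[OF S_carrier assms(2), OF assms(1)] by linarith
qed

lemma len_S [simp]: "s \<in> S \<Longrightarrow> len s = 1"
  using len_S_mult_cases[of s \<one>] by simp

section \<open>The reflections of a word, counted modulo two\<close>

text \<open>
  \<open>eta (s\<^sub>1 \<dots> s\<^sub>k) t\<close> says that \<open>t\<close> occurs an odd number of times among the reflections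
  \<open>s\<^sub>1 \<dots> s\<^sub>i\<^sub>-\<^sub>1 s\<^sub>i s\<^sub>i\<^sub>-\<^sub>1 \<dots> s\<^sub>1\<close>.
\<close>

fun eta :: "'a list \<Rightarrow> 'a \<Rightarrow> bool" where
  "eta [] t \<longleftrightarrow> False"
| "eta (s # ws) t \<longleftrightarrow> (t = s) \<noteq> eta ws (s \<otimes> t \<otimes> s)"

lemma eta_append:
  assumes "set us \<subseteq> S" "t \<in> carrier W"
  shows "eta (us @ vs) t \<longleftrightarrow> eta us t \<noteq> eta vs (inv (word_prod W us) \<otimes> t \<otimes> word_prod W us)"
  using assms by (induction us arbitrary: t) (auto simp: inv_mult_group m_assoc)

text \<open>
  The reflections of the word \<open>(s t)\<^sup>n\<close> are \<open>d\<^sup>j s\<close> for \<open>j < 2 n\<close>, where \<open>d = s t\<close>; if \<open>d\<^sup>n = 1\<close>,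
  they cancel in pairs \<open>j, j + n\<close>.
\<close>

fun dihedral_parity :: "'a \<Rightarrow> 'a \<Rightarrow> nat \<Rightarrow> 'a \<Rightarrow> bool" where
  "dihedral_parity d s 0 x \<longleftrightarrow> False"
| "dihedral_parity d s (Suc n) x \<longleftrightarrow> dihedral_parity d s n x \<noteq> (x = d [^] n \<otimes> s)"

lemma dihedral_parity_add_period:
  assumes "d \<in> carrier W" "d [^] k = \<one>"
  shows "dihedral_parity d s (k + n) x \<longleftrightarrow> dihedral_parity d s k x \<noteq> dihedral_parity d s n x"
  using assms by (induction n) (auto simp flip: nat_pow_mult)

text \<open>With \<open>d = s t\<close> and \<open>s t s = d s\<close>, conjugating
  \<open>d^n s\<close> by \<open>d\<close> raises the exponent by two. In \<open>eta\<close> this is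
  the effect of stripping one block \<open>s t\<close> from the front of the word.\<close>

lemma dihedral_shift:
  assumes "s \<in> S" "t \<in> S" "x \<in> carrier W"
  shows "x = (s \<otimes> t) [^] Suc (Suc n) \<otimes> s \<longleftrightarrow> t \<otimes> (s \<otimes> x \<otimes> s) \<otimes> t = (s \<otimes> t) [^] n \<otimes> s"
proof -
  let ?d = "s \<otimes> t"
  have c: "?d [^] n \<in> carrier W"
    using assms by auto
  have "?d [^] Suc (Suc n) \<otimes> s = ?d \<otimes> (?d [^] n \<otimes> s) \<otimes> (t \<otimes> s)"
    using assms c nat_pow_Suc2[of ?d "Suc n"] by (simp add: m_assoc)
  moreover have "x = s \<otimes> t \<otimes> (t \<otimes> (s \<otimes> x \<otimes> s) \<otimes> t) \<otimes> (t \<otimes> s)"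
    using assms by (simp add: m_assoc)
  moreover have "t \<otimes> (s \<otimes> (s \<otimes> t \<otimes> (?d [^] n \<otimes> s) \<otimes> (t \<otimes> s)) \<otimes> s) \<otimes> t = ?d [^] n \<otimes> s"
    using assms c by (simp add: m_assoc)
  ultimately show ?thesis
    by metis
qed

text \<open>The exponents \<open>0\<close> and \<open>1\<close> give the reflections
  \<open>s\<close> and \<open>s t s\<close> of the first two letters; all later ones are conjugates
  of reflections of the remaining word.\<close>

lemma dihedral_parity_shift:
  assumes "s \<in> S" "t \<in> S" "x \<in> carrier W"
  shows "dihedral_parity (s \<otimes> t) s (Suc (Suc n)) x \<longleftrightarrow>
    (x = s) \<noteq> ((s \<otimes> x \<otimes> s = t) \<noteq> dihedral_parity (s \<otimes> t) s n (t \<otimes> (s \<otimes> x \<otimes> s) \<otimes> t))"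
proof (induction n)
  case 0
  have "s \<otimes> x \<otimes> s = t \<longleftrightarrow> x = s \<otimes> t \<otimes> s"
    using assms by (auto simp: m_assoc)
  then show ?case
    using assms by (auto simp: m_assoc)
next
  case (Suc n)
  show ?case
    by (subst dihedral_parity.simps(2)) (use Suc dihedral_shift[OF assms, of n] in auto)
qed

lemma eta_dihedral:
  assumes "s \<in> S" "t \<in> S" "x \<in> carrier W"
  shows "eta (concat (replicate n [s, t])) x \<longleftrightarrow> dihedral_parity (s \<otimes> t) s (2 * n) x"
  using assms(3)
proof (induction n arbitrary: x)
  case 0
  show ?case by simp
next
  case (Suc n)
  then have "eta (concat (replicate n [s, t])) (t \<otimes> (s \<otimes> x \<otimes> s) \<otimes> t) \<longleftrightarrow>
      dihedral_parity (s \<otimes> t) s (2 * n) (t \<otimes> (s \<otimes> x \<otimes> s) \<otimes> t)"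
    using assms by simp
  then show ?case
    using dihedral_parity_shift[OF assms(1,2), of x "2 * n"] Suc.prems
    by (simp del: dihedral_parity.simps)
qed

lemma word_prod_dihedral:
  assumes "s \<in> S" "t \<in> S"
  shows "word_prod W (concat (replicate n [s, t])) = (s \<otimes> t) [^] n"
proof (induction n)
  case (Suc n)
  then show ?case
    using assms nat_pow_Suc2[of "s \<otimes> t" n] by (simp add: m_assoc)
qed simp

text \<open>A relator has product one, so inserting it does not conjugate the reflections of the
  letters after it, and its own reflections cancel in pairs. Hence \<open>eta\<close> depends only
  on the group element.\<close>

lemma eta_cong:
  assumes "coxeter_cong S m us vs" "x \<in> carrier W"
  shows "eta us x \<longleftrightarrow> eta vs x"
  using assms
proof (induction arbitrary: x rule: coxeter_cong.induct)
  case (rel s t us vs)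
  let ?r = "concat (replicate (m s t) [s, t])"
  have r: "set ?r \<subseteq> S"
    using rel by (induction "m s t") auto
  have "coxeter_cong S m ([] @ ?r @ []) ([] @ [])"
    by (rule coxeter_cong.rel) (use rel in auto)
  then have one: "word_prod W ?r = \<one>"
    using presentation[of ?r "[]"] r by simp
  have "\<not> eta ?r y" if "y \<in> carrier W" for y
    using that rel one dihedral_parity_add_period[of "s \<otimes> t" "m s t" s "m s t" y]
    by (simp add: eta_dihedral word_prod_dihedral mult_2)
  then show ?case
    using rel r one by (simp add: eta_append)
qed auto

subsection \<open>Reflections and inversions\<close>

definition reflections :: "'a set" where
  "reflections = {w \<otimes> s \<otimes> inv w | w s. w \<in> carrier W \<and> s \<in> S}"

definition inversions :: "'a \<Rightarrow> 'a set" where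
  "inversions w = {t \<in> reflections. len (t \<otimes> w) < len w}"

lemma reflections_carrier [simp]: "t \<in> reflections \<Longrightarrow> t \<in> carrier W"
  by (auto simp: reflections_def)

lemma S_reflections [simp]: "s \<in> S \<Longrightarrow> s \<in> reflections"
  unfolding reflections_def by (rule CollectI, rule exI[of _ \<one>], rule exI[of _ s]) simp

lemma reflection_conj [simp]:
  assumes "t \<in> reflections" "u \<in> carrier W"
  shows "u \<otimes> t \<otimes> inv u \<in> reflections"
proof -
  obtain w s where "w \<in> carrier W" "s \<in> S" "t = w \<otimes> s \<otimes> inv w"
    using assms unfolding reflections_def by blast
  then show ?thesis
    unfolding reflections_def using assms
    by (intro CollectI exI[of _ "u \<otimes> w"] exI[of _ s]) (simp add: m_assoc inv_mult_group)
qed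

lemma reflection_conj_inv [simp]:
  "t \<in> reflections \<Longrightarrow> u \<in> carrier W \<Longrightarrow> inv u \<otimes> t \<otimes> u \<in> reflections"
  using reflection_conj[of t "inv u"] by simp

lemma reflection_square [simp]:
  assumes "t \<in> reflections"
  shows "t \<otimes> t = \<one>"
proof -
  obtain w s where "w \<in> carrier W" "s \<in> S" "t = w \<otimes> s \<otimes> inv w"
    using assms unfolding reflections_def by blast
  then show ?thesis
    by (simp add: m_assoc)
qed

lemma reflection_cancel [simp]: "t \<in> reflections \<Longrightarrow> x \<in> carrier W \<Longrightarrow> t \<otimes> (t \<otimes> x) = x"
  by (simp flip: m_assoc)

text \<open>This is the strong exchange condition: if \<open>t = p s (inv p)\<close> for a prefix
  \<open>p\<close> followed by the letter \<open>s\<close>, then multiplying by \<open>t\<close> on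
  the left deletes that letter.\<close>

lemma eta_deletion:
  assumes "set ws \<subseteq> S" "t \<in> carrier W" "eta ws t"
  obtains us s vs where "ws = us @ s # vs" "t \<otimes> word_prod W ws = word_prod W (us @ vs)"
proof -
  have "\<exists>us s vs. ws = us @ s # vs \<and> t \<otimes> word_prod W ws = word_prod W (us @ vs)"
    using assms
  proof (induction ws arbitrary: t)
    case (Cons s ws)
    show ?case
    proof (cases "t = s")
      case True
      then show ?thesis
        using Cons by (intro exI[of _ "[]"] exI[of _ s] exI[of _ ws]) auto
    next
      case False
      then obtain us r vs where *: "ws = us @ r # vs"
        "(s \<otimes> t \<otimes> s) \<otimes> word_prod W ws = word_prod W (us @ vs)"
        using Cons.IH[of "s \<otimes> t \<otimes> s"] Cons.prems by auto
      have "t \<otimes> (s \<otimes> word_prod W ws) = s \<otimes> ((s \<otimes> t \<otimes> s) \<otimes> word_prod W ws)"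
        using Cons.prems by (simp add: m_assoc)
      with * show ?thesis
        by (intro exI[of _ "s # us"] exI[of _ r] exI[of _ vs]) simp
    qed
  qed simp
  with that show thesis by blast
qed

text \<open>In the palindromic word for \<open>w s (inv w)\<close> the middle letter contributes
  \<open>t\<close> once. The two halves contribute as much as the word \<open>us @ rev us\<close>,
  whose product is one, hence nothing.\<close>

lemma eta_self:
  assumes "t \<in> reflections" "set ws \<subseteq> S" "word_prod W ws = t"
  shows "eta ws t"
proof -
  obtain w s where w: "w \<in> carrier W" "s \<in> S" "t = w \<otimes> s \<otimes> inv w"
    using assms unfolding reflections_def by blast
  obtain us where us: "set us \<subseteq> S" "word_prod W us = w"
    using w reduced_word by metis
  have "eta ws t \<longleftrightarrow> eta (us @ [s] @ rev us) t"
    using assms us w presentation[of ws "us @ [s] @ rev us"]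
    by (intro eta_cong) (auto simp: word_prod_append word_prod_rev m_assoc)
  moreover have "inv w \<otimes> t \<otimes> w = s"
    using w by (simp add: m_assoc)
  moreover have "\<not> eta (us @ rev us) t"
    using eta_cong[of "us @ rev us" "[]" t] presentation[of "us @ rev us" "[]"] us w
    by (auto simp: word_prod_append word_prod_rev)
  ultimately show ?thesis
    using us w by (simp add: eta_append m_assoc)
qed

text \<open>If \<open>eta\<close> holds, deleting a letter from a reduced word makes
  \<open>t w\<close> shorter than \<open>w\<close>. If it fails for \<open>w\<close>, it holds for
  \<open>t w\<close> because \<open>eta\<close> holds for \<open>t\<close> itself, so
  \<open>w = t (t w)\<close> is shorter than \<open>t w\<close> and \<open>t\<close> is no inversion
  of \<open>w\<close>.\<close>

lemma inversions_iff_eta: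
  assumes "t \<in> reflections" "set ws \<subseteq> S"
  shows "t \<in> inversions (word_prod W ws) \<longleftrightarrow> eta ws t"
proof -
  have less: "len (t \<otimes> word_prod W ws) < len (word_prod W ws)" if ws: "eta ws t" "set ws \<subseteq> S" for ws
  proof -
    obtain rs where rs: "set rs \<subseteq> S" "word_prod W rs = word_prod W ws"
      "length rs = len (word_prod W ws)"
      by (rule reduced_word[OF word_prod_closed[OF ws(2)]])
    have "eta rs t"
      using ws rs assms eta_cong[of rs ws t] presentation[of rs ws] by auto
    then obtain us s vs where *: "rs = us @ s # vs" "t \<otimes> word_prod W rs = word_prod W (us @ vs)"
      by (rule eta_deletion[OF rs(1) reflections_carrier[OF assms(1)]])
    then have "len (t \<otimes> word_prod W rs) \<le> length (us @ vs)"
      using len_le_length[of "us @ vs"] rs by simp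
    also have "\<dots> < len (word_prod W rs)"
      using * rs by simp
    finally show ?thesis using rs by simp
  qed
  show ?thesis
  proof
    assume "eta ws t"
    then show "t \<in> inversions (word_prod W ws)"
      using less assms by (simp add: inversions_def)
  next
    assume inv: "t \<in> inversions (word_prod W ws)"
    obtain rs where rs: "set rs \<subseteq> S" "word_prod W rs = t"
      by (rule reduced_word[OF reflections_carrier[OF assms(1)]])
    have "eta (rs @ ws) t \<longleftrightarrow> \<not> eta ws t"
      using rs assms eta_self[of t rs] by (simp add: eta_append)
    then show "eta ws t"
      using less[of "rs @ ws"] rs assms inv by (auto simp: word_prod_append inversions_def)
  qed
qed

lemma inversions_mult:
  assumes "t \<in> reflections" "u \<in> carrier W" "v \<in> carrier W"
  shows "t \<in> inversions (u \<otimes> v) \<longleftrightarrow> (t \<in> inversions u) \<noteq> (inv u \<otimes> t \<otimes> u \<in> inversions v)"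
proof -
  obtain us vs where w: "set us \<subseteq> S" "word_prod W us = u" "set vs \<subseteq> S" "word_prod W vs = v"
    using assms reduced_word by metis
  show ?thesis
    using inversions_iff_eta[of t "us @ vs"] inversions_iff_eta[of t us]
      inversions_iff_eta[of "inv u \<otimes> t \<otimes> u" vs] w assms
    by (simp add: word_prod_append eta_append)
qed

lemma inversions_subset: "inversions w \<subseteq> reflections"
  by (auto simp: inversions_def)

text \<open>Since \<open>t\<close> is an inversion of itself, the cocycle rule makes it an inversion
  of exactly one of \<open>w\<close> and \<open>t \<otimes> w\<close>.\<close>

lemma not_inversion_less:
  assumes "t \<in> reflections" "w \<in> carrier W" "t \<notin> inversions w"
  shows "len w < len (t \<otimes> w)"
proof -
  obtain rs where "set rs \<subseteq> S" "word_prod W rs = t"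
    by (rule reduced_word[OF reflections_carrier[OF assms(1)]])
  then have "t \<in> inversions t"
    using assms(1) inversions_iff_eta eta_self by metis
  then have "t \<in> inversions (t \<otimes> w)"
    using assms by (simp add: inversions_mult)
  then show ?thesis
    using assms by (simp add: inversions_def)
qed

abbreviation conj_set :: "'a \<Rightarrow> 'a set \<Rightarrow> 'a set" where
  "conj_set u X \<equiv> (\<lambda>t. u \<otimes> t \<otimes> inv u) ` X"

lemma mem_conj_set_iff:
  assumes "t \<in> carrier W" "u \<in> carrier W" "X \<subseteq> carrier W"
  shows "t \<in> conj_set u X \<longleftrightarrow> inv u \<otimes> t \<otimes> u \<in> X"
proof
  assume "t \<in> conj_set u X"
  then obtain x where "x \<in> X" "t = u \<otimes> x \<otimes> inv u"
    by blast
  then show "inv u \<otimes> t \<otimes> u \<in> X"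
    using assms by (simp add: m_assoc subset_iff)
next
  assume *: "inv u \<otimes> t \<otimes> u \<in> X"
  have "t = u \<otimes> (inv u \<otimes> t \<otimes> u) \<otimes> inv u"
    using assms by (simp add: m_assoc)
  with * show "t \<in> conj_set u X"
    by blast
qed

lemma inj_on_conj: "u \<in> carrier W \<Longrightarrow> inj_on (\<lambda>t. u \<otimes> t \<otimes> inv u) (carrier W)"
  by (rule inj_onI) simp

lemma inversions_carrier: "inversions w \<subseteq> carrier W"
  using inversions_subset by fastforce

lemma inversions_mult_eq:
  assumes "u \<in> carrier W" "v \<in> carrier W"
  shows "inversions (u \<otimes> v) = (inversions u - conj_set u (inversions v)) \<union>
    (conj_set u (inversions v) - inversions u)" (is "?L = ?R")
proof -
  have R: "?R \<subseteq> reflections"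
    using inversions_subset assms by fastforce
  have "t \<in> ?L \<longleftrightarrow> t \<in> ?R" if "t \<in> reflections" for t
    using that assms inversions_mult[of t u v]
      mem_conj_set_iff[OF reflections_carrier[OF that] assms(1) inversions_carrier, of v]
    by blast
  then show ?thesis
    using R inversions_subset[of "u \<otimes> v"] by blast
qed

lemma inversions_one [simp]: "inversions \<one> = {}"
  by (auto simp: inversions_def)

lemma S_inversions_iff: "s \<in> S \<Longrightarrow> s \<in> inversions w \<longleftrightarrow> len (s \<otimes> w) < len w"
  by (simp add: inversions_def)

lemma inversions_S_mult:
  assumes "s \<in> S" "w \<in> carrier W" "len (s \<otimes> w) = Suc (len w)"
  shows "inversions (s \<otimes> w) = insert s (conj_set s (inversions w))"
    "s \<notin> conj_set s (inversions w)"
proof -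
  have "s \<notin> inversions w"
    using assms by (simp add: S_inversions_iff)
  then show "s \<notin> conj_set s (inversions w)"
    using assms mem_conj_set_iff[of s s "inversions w"] inversions_carrier by auto
  moreover have "inversions s = {s}"
  proof -
    have "t \<otimes> s = \<one> \<Longrightarrow> t = s" if "t \<in> carrier W" for t
      using that assms(1) by (metis S_carrier S_inv inv_equality)
    then show ?thesis
      using assms by (auto simp: inversions_def len_zero_iff)
  qed
  ultimately show "inversions (s \<otimes> w) = insert s (conj_set s (inversions w))"
    using inversions_mult_eq[of s w] assms by auto
qed

lemma obtain_left_descent:
  assumes "w \<in> carrier W" "w \<noteq> \<one>"
  obtains s where "s \<in> S" "len w = Suc (len (s \<otimes> w))"
proof -
  obtain ws where ws: "set ws \<subseteq> S" "word_prod W ws = w" "length ws = len w"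
    by (rule reduced_word[OF assms(1)])
  then obtain s vs where s: "ws = s # vs"
    using assms by (cases ws) auto
  have "s \<otimes> w = word_prod W vs"
    using s ws by auto
  then have "len (s \<otimes> w) < len w"
    using len_le_length[of vs] s ws by auto
  then show thesis
    using that[of s] len_S_mult_cases[of s w] s ws assms by auto
qed

text \<open>Restoring a left descent \<open>s\<close> conjugates the inversions of the shorter
  element and adds exactly one new one, \<open>s\<close> itself.\<close>

lemma finite_inversions_card:
  "w \<in> carrier W \<Longrightarrow> finite (inversions w) \<and> card (inversions w) = len w"
proof (induction "len w" arbitrary: w)
  case 0
  then show ?case
    using len_zero_iff by simp
next
  case (Suc n)
  then have "w \<noteq> \<one>"
    by auto
  then obtain s where s: "s \<in> S" "len w = Suc (len (s \<otimes> w))"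
    using obtain_left_descent Suc.prems by blast
  let ?v = "s \<otimes> w"
  have v: "finite (inversions ?v)" "card (inversions ?v) = len ?v"
    using Suc s by auto
  have w: "w = s \<otimes> ?v"
    using s Suc.prems by simp
  have "inversions w = insert s (conj_set s (inversions ?v))" "s \<notin> conj_set s (inversions ?v)"
    using inversions_S_mult[of s ?v] s Suc.prems w by auto
  moreover have "card (conj_set s (inversions ?v)) = card (inversions ?v)"
    using s inj_on_subset[OF inj_on_conj[of s] inversions_carrier] by (intro card_image) auto
  ultimately show ?case
    using v s by simp
qed

lemma finite_inversions [simp]: "w \<in> carrier W \<Longrightarrow> finite (inversions w)"
  and card_inversions: "w \<in> carrier W \<Longrightarrow> card (inversions w) = len w"
  using finite_inversions_card by auto

text \<open>Lengths count inversions and the cocycle rule is a symmetric difference, so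
  \<open>len u + len v - len (u \<otimes> v)\<close> is twice the size of the overlap.\<close>

lemma len_mult_eq_iff:
  assumes "u \<in> carrier W" "v \<in> carrier W"
  shows "len (u \<otimes> v) = len u + len v \<longleftrightarrow> inversions u \<inter> conj_set u (inversions v) = {}"
proof -
  let ?C = "conj_set u (inversions v)"
  have C: "finite ?C" "card ?C = len v"
    using assms inj_on_subset[OF inj_on_conj[of u] inversions_carrier]
    by (auto simp: card_image card_inversions)
  then have "len (u \<otimes> v) + 2 * card (inversions u \<inter> ?C) = len u + len v"
    using card_sym_diff[of "inversions u" ?C] assms inversions_mult_eq[of u v]
    by (simp flip: card_inversions)
  moreover have "card (inversions u \<inter> ?C) = 0 \<longleftrightarrow> inversions u \<inter> ?C = {}"
    using assms by simp
  ultimately show ?thesis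
    by linarith
qed

text \<open>Write \<open>v = u (inv u v)\<close>: the inversions of \<open>u\<close> survive in
  \<open>v\<close> precisely when none of them meets the conjugated inversions of the second
  factor.\<close>

lemma wle_iff_inversions:
  assumes "u \<in> carrier W" "v \<in> carrier W"
  shows "u \<preceq> v \<longleftrightarrow> inversions u \<subseteq> inversions v"
  using len_mult_eq_iff[of u "inv u \<otimes> v"] inversions_mult_eq[of u "inv u \<otimes> v"] assms
  by (auto simp: wle_def)

lemma wle_refl [simp]: "u \<in> carrier W \<Longrightarrow> u \<preceq> u"
  by (simp add: wle_def)

lemma wle_trans:
  "u \<preceq> v \<Longrightarrow> v \<preceq> w \<Longrightarrow> u \<in> carrier W \<Longrightarrow> v \<in> carrier W \<Longrightarrow> w \<in> carrier W \<Longrightarrow> u \<preceq> w"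
  by (simp add: wle_iff_inversions)

lemma wle_antisym:
  assumes "u \<preceq> v" "v \<preceq> u" "u \<in> carrier W" "v \<in> carrier W"
  shows "u = v"
proof -
  have "len (inv u \<otimes> v) = 0"
    using assms(1,2) unfolding wle_def by linarith
  then have "inv u \<otimes> v = \<one>"
    using len_zero_iff assms by simp
  then show ?thesis
    using assms by (metis inv_equality inv_closed inv_inv)
qed

lemma wle_len_eq:
  assumes "u \<preceq> v" "len v \<le> len u" "u \<in> carrier W" "v \<in> carrier W"
  shows "u = v"
proof -
  have "len (inv u \<otimes> v) = 0"
    using assms(1,2) unfolding wle_def by linarith
  then show ?thesis
    using assms len_zero_iff[of "inv u \<otimes> v"] by (metis inv_equality inv_closed inv_inv m_closed)
qed

lemma one_wle [simp]: "u \<in> carrier W \<Longrightarrow> \<one> \<preceq> u"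
  by (simp add: wle_def)

lemma wle_translate:
  assumes "u \<preceq> v" "u \<preceq> w" "u \<in> carrier W" "v \<in> carrier W" "w \<in> carrier W"
  shows "inv u \<otimes> v \<preceq> inv u \<otimes> w \<longleftrightarrow> v \<preceq> w"
proof -
  have "inv (inv u \<otimes> v) \<otimes> (inv u \<otimes> w) = inv v \<otimes> w"
    using assms by (simp add: inv_mult_group m_assoc)
  then show ?thesis
    using assms(1,2) by (auto simp: wle_def)
qed

lemma S_wle_iff:
  assumes "s \<in> S" "w \<in> carrier W"
  shows "s \<preceq> w \<longleftrightarrow> s \<in> inversions w"
  using assms len_S_mult_cases[of s w] by (auto simp: S_inversions_iff wle_def)

lemma left_descents_eq: "left_descents W S w = S \<inter> inversions w"
  by (auto simp: left_descents_def S_inversions_iff)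

subsection \<open>Parabolic subgroups\<close>

lemma parab_subgroup: "I \<subseteq> S \<Longrightarrow> subgroup (parab I) W"
  using S_subset by (intro generate_is_subgroup) auto

lemma parab_carrier: "I \<subseteq> S \<Longrightarrow> u \<in> parab I \<Longrightarrow> u \<in> carrier W"
  using subgroup.mem_carrier[OF parab_subgroup] .

lemma parab_mult: "u \<in> parab I \<Longrightarrow> v \<in> parab I \<Longrightarrow> u \<otimes> v \<in> parab I"
  by (rule generate.eng)

lemma parab_inv: "I \<subseteq> S \<Longrightarrow> u \<in> parab I \<Longrightarrow> inv u \<in> parab I"
  using subgroup.m_inv_closed[OF parab_subgroup] .

lemma parab_incl: "s \<in> I \<Longrightarrow> s \<in> parab I"
  by (rule generate.incl)

text \<open>The reduced word is built letter by letter. When a new letter shortens the product,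
  exchange deletes a letter already present, so no letter outside \<open>I\<close> ever
  appears.\<close>

lemma parab_reduced_word:
  assumes "I \<subseteq> S" "u \<in> parab I"
  obtains ws where "set ws \<subseteq> I" "word_prod W ws = u" "length ws = len u"
proof -
  have "\<exists>rs. set rs \<subseteq> I \<and> word_prod W rs = word_prod W ws \<and> length rs = len (word_prod W ws)"
    if "set ws \<subseteq> I" for ws
    using that
  proof (induction ws)
    case (Cons s ws)
    then obtain rs where rs: "set rs \<subseteq> I" "word_prod W rs = word_prod W ws"
      "length rs = len (word_prod W ws)" by auto
    have sI: "s \<in> S" "set rs \<subseteq> S" "set ws \<subseteq> S"
      using Cons.prems rs assms by auto
    show ?case
    proof (cases "s \<in> inversions (word_prod W rs)")
      case True
      then have "eta rs s"
        using inversions_iff_eta[of s rs] sI by simp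
      then obtain us r vs where *: "rs = us @ r # vs" "s \<otimes> word_prod W rs = word_prod W (us @ vs)"
        using eta_deletion[of rs s] sI S_carrier by metis
      \<comment> \<open>Deleting a letter and multiplying by a descent both lower the length by
        exactly one, so the new word is again reduced.\<close>
      have "length (us @ vs) = len (s \<otimes> word_prod W ws)"
        using True len_S_mult_cases[of s "word_prod W rs"] sI rs * by (auto simp: S_inversions_iff)
      then show ?thesis
        using * rs by (intro exI[of _ "us @ vs"]) auto
    next
      case False
      then have "len (s \<otimes> word_prod W ws) = Suc (length rs)"
        using len_S_mult_cases[of s "word_prod W rs"] sI rs by (auto simp: S_inversions_iff)
      then show ?thesis
        using Cons.prems rs by (intro exI[of _ "s # rs"]) auto
    qed
  qed auto
  with that generate_word[OF assms] show thesis by metis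
qed

lemma S_parab_iff: "I \<subseteq> S \<Longrightarrow> s \<in> S \<Longrightarrow> s \<in> parab I \<longleftrightarrow> s \<in> I"
proof
  assume *: "I \<subseteq> S" "s \<in> S" "s \<in> parab I"
  obtain ws where ws: "set ws \<subseteq> I" "word_prod W ws = s" "length ws = len s"
    by (rule parab_reduced_word[OF *(1,3)])
  then obtain r where "ws = [r]"
    using * by (auto simp: length_Suc_conv)
  then show "s \<in> I"
    using ws * by auto
qed (rule parab_incl)

text \<open>Each reflection of a word over \<open>I\<close> is the conjugate of a letter by a prefix
  of that word.\<close>

lemma inversions_parab:
  assumes "I \<subseteq> S" "u \<in> parab I"
  shows "inversions u \<subseteq> parab I"
proof
  fix t assume t: "t \<in> inversions u"
  obtain ws where ws: "set ws \<subseteq> I" "word_prod W ws = u"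
    by (rule generate_word[OF assms])
  have "t \<in> parab I" if "eta ws t" "t \<in> carrier W" "set ws \<subseteq> I" for t
    using that
  proof (induction ws arbitrary: t)
    case (Cons s ws)
    then have s: "s \<in> S" "s \<in> parab I"
      using assms by (auto intro: generate.incl)
    show ?case
    proof (cases "t = s")
      case False
      then have "s \<otimes> t \<otimes> s \<in> parab I"
        using Cons s by auto
      then have "s \<otimes> (s \<otimes> t \<otimes> s) \<otimes> s \<in> parab I"
        using s parab_mult by blast
      then show ?thesis
        using s Cons.prems by (simp add: m_assoc)
    qed (use s in simp)
  qed simp
  moreover have "t \<in> reflections"
    using t inversions_subset by auto
  ultimately show "t \<in> parab I"
    using inversions_iff_eta[of t ws] ws assms t by auto
qed

lemma min_repsD: "x \<in> min_reps W S I \<Longrightarrow> x \<in> carrier W"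
  by (simp add: min_reps_def)

text \<open>A common element of the two inversion sets would be \<open>x t (inv x)\<close> with
  \<open>t\<close> in the subgroup, and then \<open>x \<otimes> t\<close> would be shorter than
  \<open>x\<close>.\<close>

lemma len_min_coset_mult:
  assumes "I \<subseteq> S" "x \<in> carrier W" "u \<in> parab I"
    and min: "\<And>v. v \<in> parab I \<Longrightarrow> len x \<le> len (x \<otimes> v)"
  shows "len (x \<otimes> u) = len x + len u"
proof -
  have u: "u \<in> carrier W"
    using assms parab_carrier by blast
  have "x \<otimes> t \<otimes> inv x \<notin> inversions x" if t: "t \<in> inversions u" for t
  proof -
    have "t \<in> parab I" "t \<in> carrier W"
      using t inversions_parab[OF assms(1,3)] inversions_carrier by auto
    moreover from this have "len x \<le> len (x \<otimes> t)"
      using min by blast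
    ultimately show ?thesis
      using assms(2) by (auto simp: inversions_def m_assoc)
  qed
  then show ?thesis
    using len_mult_eq_iff[OF assms(2) u] by auto
qed

lemma min_rep_exists:
  assumes "I \<subseteq> S" "g \<in> carrier W"
  obtains x v where "x \<in> carrier W" "v \<in> parab I" "g = x \<otimes> v"
    "\<And>u. u \<in> parab I \<Longrightarrow> len (x \<otimes> u) = len x + len u"
proof -
  define P where "P v \<longleftrightarrow> v \<in> parab I" for v
  have "P \<one>"
    by (simp add: P_def generate.one)
  then obtain v where v: "P v" "\<And>u. P u \<Longrightarrow> len (g \<otimes> v) \<le> len (g \<otimes> u)"
    using ex_has_least_nat[of P \<one> "\<lambda>v. len (g \<otimes> v)"] by blast
  have vc: "v \<in> parab I" "v \<in> carrier W"
    using v assms parab_carrier by (auto simp: P_def)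
  have "len (g \<otimes> v) \<le> len (g \<otimes> v \<otimes> u)" if u: "u \<in> parab I" for u
    using v(2)[of "v \<otimes> u"] vc u parab_mult assms parab_carrier by (simp add: P_def m_assoc)
  then have "len (g \<otimes> v \<otimes> u) = len (g \<otimes> v) + len u" if "u \<in> parab I" for u
    using len_min_coset_mult[of I "g \<otimes> v" u] that vc assms by simp
  then show thesis
    using that[of "g \<otimes> v" "inv v"] vc assms parab_inv by (simp add: m_assoc)
qed

lemma obtain_right_descent_parab:
  assumes "I \<subseteq> S" "u \<in> parab I" "u \<noteq> \<one>"
  obtains s where "s \<in> I" "len (u \<otimes> s) < len u"
proof -
  obtain ws where ws: "set ws \<subseteq> I" "word_prod W ws = u" "length ws = len u"
    by (rule parab_reduced_word[OF assms(1,2)])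
  then obtain vs s where s: "ws = vs @ [s]"
    using assms(3) by (cases ws rule: rev_cases) auto
  have vs: "set vs \<subseteq> S" "s \<in> S"
    using s ws assms(1) by auto
  then have "u \<otimes> s = word_prod W vs"
    using s word_prod_append[of vs "[s]"] by (simp flip: ws(2))
  moreover have "len (word_prod W vs) < len u"
    using len_le_length[OF vs(1)] ws(3) s by simp
  ultimately have "len (u \<otimes> s) < len u"
    by simp
  then show thesis
    using that s ws by auto
qed

text \<open>Membership in \<open>min_reps\<close> only tests single letters. Comparing
  \<open>x\<close> with a shortest element \<open>y\<close> of its coset, \<open>x = y v\<close>, a
  nontrivial \<open>v\<close> would end in a letter of \<open>I\<close> that shortens
  \<open>x\<close>.\<close>

lemma len_min_rep_mult:
  assumes "I \<subseteq> S" "x \<in> min_reps W S I" "u \<in> parab I"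
  shows "len (x \<otimes> u) = len x + len u"
proof -
  have x: "x \<in> carrier W"
    using assms min_repsD by blast
  obtain y v where y: "y \<in> carrier W" "v \<in> parab I" "x = y \<otimes> v"
    "\<And>u. u \<in> parab I \<Longrightarrow> len (y \<otimes> u) = len y + len u"
    using min_rep_exists[OF assms(1) x] by metis
  have v: "v \<in> carrier W"
    using y assms parab_carrier by blast
  have "v = \<one>"
  proof (rule ccontr)
    assume "v \<noteq> \<one>"
    then obtain s where s: "s \<in> I" "len (v \<otimes> s) < len v"
      by (rule obtain_right_descent_parab[OF assms(1) y(2)])
    then have "len (x \<otimes> s) < len x"
      using y(4)[of "v \<otimes> s"] y v assms(1) parab_mult[OF y(2) parab_incl[OF s(1)]]
      by (auto simp: m_assoc)
    then show False
      using assms s by (auto simp: min_reps_def)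
  qed
  then show ?thesis
    using y assms by simp
qed

lemma min_repsI:
  assumes "I \<subseteq> S" "x \<in> carrier W" "\<And>u. u \<in> parab I \<Longrightarrow> len (x \<otimes> u) = len x + len u"
  shows "x \<in> min_reps W S I"
  unfolding min_reps_def using assms parab_incl[of _ I] by auto

lemma min_rep_decomp:
  assumes "I \<subseteq> S" "g \<in> carrier W"
  obtains x v where "x \<in> min_reps W S I" "v \<in> parab I" "g = x \<otimes> v"
  using min_rep_exists[OF assms] min_repsI[OF assms(1)] by metis

text \<open>Additivity of lengths is applied to \<open>x \<otimes> inv x = \<one>\<close>.\<close>

lemma min_reps_parab:
  assumes "I \<subseteq> S" "x \<in> min_reps W S I" "x \<in> parab I"
  shows "x = \<one>"
  using len_min_rep_mult[OF assms(1,2) parab_inv[OF assms(1,3)]] min_repsD[OF assms(2)]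
  by (simp add: len_zero_iff)

lemma min_rep_wle:
  assumes "I \<subseteq> S" "x \<in> min_reps W S I" "u \<in> parab I"
  shows "x \<preceq> x \<otimes> u"
  using len_min_rep_mult[OF assms] assms min_repsD parab_carrier by (simp add: wle_def)

lemma len_one_S:
  assumes "w \<in> carrier W" "len w = 1"
  shows "w \<in> S"
proof -
  obtain ws where "set ws \<subseteq> S" "word_prod W ws = w" "length ws = 1"
    using reduced_word[OF assms(1)] assms(2) by metis
  then show ?thesis
    by (auto simp: length_Suc_conv)
qed

text \<open>Left translation identifies the interval from \<open>x\<close> to \<open>z\<close> with
  the one from \<open>\<one>\<close> to \<open>inv x \<otimes> z\<close>. From left to right, the
  triangle inequalities for \<open>x u\<close> and for \<open>z\<close> have no slack left.\<close>

lemma wle_inv_mult_iff: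
  assumes "x \<preceq> z" "x \<in> carrier W" "u \<in> carrier W" "z \<in> carrier W"
  shows "u \<preceq> inv x \<otimes> z \<longleftrightarrow> x \<preceq> x \<otimes> u \<and> x \<otimes> u \<preceq> z"
proof
  assume u: "u \<preceq> inv x \<otimes> z"
  have *: "inv (x \<otimes> u) \<otimes> z = inv u \<otimes> (inv x \<otimes> z)"
    using assms by (simp add: inv_mult_group m_assoc)
  have "len z \<le> len (x \<otimes> u) + len (inv (x \<otimes> u) \<otimes> z)"
    using len_mult_le[of "x \<otimes> u" "inv (x \<otimes> u) \<otimes> z"] assms by simp
  moreover have "len (x \<otimes> u) \<le> len x + len u"
    using len_mult_le assms by simp
  ultimately show "x \<preceq> x \<otimes> u \<and> x \<otimes> u \<preceq> z"
    using u assms * by (simp add: wle_def)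
next
  assume *: "x \<preceq> x \<otimes> u \<and> x \<otimes> u \<preceq> z"
  then show "u \<preceq> inv x \<otimes> z"
    using wle_translate[of x "x \<otimes> u" z] assms by simp
qed

end

subsection \<open>Longest elements\<close>

locale finite_coxeter = coxeter +
  assumes finite_carrier: "finite (carrier W)"
begin

abbreviation lw :: "'a set \<Rightarrow> 'a" where
  "lw I \<equiv> longest_elem W S I"

text \<open>At an element of maximal length every reflection of the subgroup must shorten. As
  inversion sets determine elements, this makes the longest element unique.\<close>

lemma maximal_inversions:
  assumes "I \<subseteq> S" "w \<in> parab I" "\<And>v. v \<in> parab I \<Longrightarrow> len v \<le> len w"
  shows "inversions w = reflections \<inter> parab I"
proof
  show "inversions w \<subseteq> reflections \<inter> parab I"
    using inversions_parab[OF assms(1,2)] inversions_subset by blast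
  show "reflections \<inter> parab I \<subseteq> inversions w"
  proof
    fix t assume t: "t \<in> reflections \<inter> parab I"
    then have "len (t \<otimes> w) \<le> len w"
      using assms parab_mult by blast
    then show "t \<in> inversions w"
      using not_inversion_less[of t w] t parab_carrier[OF assms(1,2)] by force
  qed
qed

lemma longest_elem_eqI:
  assumes "I \<subseteq> S" "w \<in> parab I" "\<And>v. v \<in> parab I \<Longrightarrow> len v \<le> len w"
  shows "lw I = w"
  unfolding longest_elem_def
proof (rule the_equality)
  fix u assume u: "u \<in> parab I \<and> (\<forall>v\<in>parab I. len v \<le> len u)"
  then have "inversions u = inversions w"
    using maximal_inversions[of I u] maximal_inversions[OF assms] assms(1) by blast
  then show "u = w"
    using u assms(1,2) parab_carrier wle_iff_inversions[of u w] wle_iff_inversions[of w u]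
    by (intro wle_antisym) auto
qed (use assms in auto)

lemma longest_elem:
  assumes "I \<subseteq> S"
  shows lw_parab: "lw I \<in> parab I" and lw_max: "\<And>v. v \<in> parab I \<Longrightarrow> len v \<le> len (lw I)"
proof -
  have "finite (parab I)"
    using finite_carrier parab_carrier[OF assms] by (meson finite_subset subsetI)
  then have fin: "finite (len ` parab I)"
    by simp
  have "len ` parab I \<noteq> {}"
    using generate.one by blast
  then obtain w where w: "w \<in> parab I" "len w = Max (len ` parab I)"
    using Max_in[OF fin] by (metis imageE)
  then have "\<And>v. v \<in> parab I \<Longrightarrow> len v \<le> len w"
    using Max_ge[OF fin] by simp
  with w(1) have "lw I = w" "\<And>v. v \<in> parab I \<Longrightarrow> len v \<le> len w"
    using longest_elem_eqI[OF assms, of w] by auto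
  then show "lw I \<in> parab I" "\<And>v. v \<in> parab I \<Longrightarrow> len v \<le> len (lw I)"
    using w(1) by auto
qed

lemma lw_carrier [simp]: "I \<subseteq> S \<Longrightarrow> lw I \<in> carrier W"
  using lw_parab parab_carrier by blast

lemma inversions_lw: "I \<subseteq> S \<Longrightarrow> inversions (lw I) = reflections \<inter> parab I"
  using maximal_inversions lw_parab lw_max by blast

lemma lw_inv [simp]:
  assumes "I \<subseteq> S"
  shows "inv (lw I) = lw I"
proof -
  have "lw I = inv (lw I)"
    using assms parab_inv lw_parab lw_max by (intro longest_elem_eqI) simp_all
  then show ?thesis by simp
qed

lemma lw_square [simp]: "I \<subseteq> S \<Longrightarrow> lw I \<otimes> lw I = \<one>"
  using l_inv[of "lw I"] by simp

lemma lw_cancel [simp]: "I \<subseteq> S \<Longrightarrow> x \<in> carrier W \<Longrightarrow> lw I \<otimes> (lw I \<otimes> x) = x"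
  by (simp flip: m_assoc)

lemma parab_wle_lw:
  assumes "I \<subseteq> S" "u \<in> parab I"
  shows "u \<preceq> lw I"
proof -
  have "inversions u \<subseteq> inversions (lw I)"
    using inversions_parab[OF assms] inversions_subset[of u] inversions_lw[OF assms(1)] by blast
  then show ?thesis
    using assms parab_carrier wle_iff_inversions[of u "lw I"] by simp
qed

lemma len_mult_lw:
  assumes "I \<subseteq> S" "u \<in> parab I"
  shows "len (u \<otimes> lw I) + len u = len (lw I)"
  using parab_wle_lw[OF assms(1) parab_inv[OF assms]] parab_carrier[OF assms] by (simp add: wle_def)

lemma len_lw_mult:
  assumes "I \<subseteq> S" "u \<in> parab I"
  shows "len (lw I \<otimes> u) + len u = len (lw I)"
proof -
  have "len (lw I \<otimes> u) = len (inv u \<otimes> lw I)"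
    using len_inv[of "lw I \<otimes> u"] parab_carrier[OF assms] assms(1) by (simp add: inv_mult_group)
  then show ?thesis
    using len_mult_lw[OF assms(1) parab_inv[OF assms]] parab_carrier[OF assms] by simp
qed

text \<open>For the converse write \<open>inv u = x v\<close> with \<open>x\<close> minimal in its
  coset. Each letter of \<open>I\<close> shortens \<open>v\<close> on the right, hence lengthens
  \<open>lw I \<otimes> v\<close>, which lies in the subgroup and so must be \<open>\<one>\<close>.
  Thus \<open>u = lw I \<otimes> inv x\<close> with lengths adding.\<close>

lemma lw_wle_iff:
  assumes "I \<subseteq> S" "u \<in> carrier W"
  shows "lw I \<preceq> u \<longleftrightarrow> I \<subseteq> inversions u"
proof
  assume "lw I \<preceq> u"
  then have "inversions (lw I) \<subseteq> inversions u"
    using wle_iff_inversions assms by simp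
  then show "I \<subseteq> inversions u"
    using assms inversions_lw[OF assms(1)] parab_incl[of _ I] S_reflections by blast
next
  assume desc: "I \<subseteq> inversions u"
  obtain x v where x: "x \<in> min_reps W S I" "v \<in> parab I" "inv u = x \<otimes> v"
    by (rule min_rep_decomp[OF assms(1) inv_closed[OF assms(2)]])
  have c: "x \<in> carrier W" "v \<in> carrier W"
    using x assms parab_carrier min_repsD by auto
  have lenu: "len u = len x + len v"
    using len_min_rep_mult[OF assms(1) x(1,2)] x(3) len_inv[OF assms(2)] by simp
  have "lw I \<otimes> v \<in> min_reps W S I"
    unfolding min_reps_def
  proof (intro CollectI conjI ballI)
    fix s assume s: "s \<in> I"
    then have sS: "s \<in> S" and vs: "v \<otimes> s \<in> parab I"
      using assms parab_mult[OF x(2) parab_incl] by auto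
    have "len (s \<otimes> u) < len u"
      using desc s by (auto simp: inversions_def)
    moreover have "len (s \<otimes> u) = len (x \<otimes> (v \<otimes> s))"
      using x(3) assms c sS len_inv[of "s \<otimes> u"] by (simp add: inv_mult_group m_assoc)
    ultimately have "len (v \<otimes> s) < len v"
      using len_min_rep_mult[OF assms(1) x(1) vs] lenu by simp
    then show "len (lw I \<otimes> v) < len (lw I \<otimes> v \<otimes> s)"
      using len_lw_mult[OF assms(1) vs] len_lw_mult[OF assms(1) x(2)] assms c sS
      by (simp add: m_assoc)
  qed (use assms c in simp)
  then have "lw I \<otimes> v = \<one>"
    using min_reps_parab[OF assms(1)] parab_mult lw_parab assms x by blast
  then have v: "v = lw I"
    using assms c by (metis lw_carrier lw_inv inv_equality inv_inv)
  have "u = lw I \<otimes> inv x"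
    using x(3) v assms c by (metis inv_inv inv_mult_group lw_carrier lw_inv)
  then show "lw I \<preceq> u"
    using lenu v assms c by (simp add: wle_def)
qed

lemma lw_mono_iff:
  assumes "I \<subseteq> S" "J \<subseteq> S"
  shows "lw I \<preceq> lw J \<longleftrightarrow> I \<subseteq> J"
proof -
  have "s \<in> inversions (lw J) \<longleftrightarrow> s \<in> J" if "s \<in> I" for s
    using that assms S_parab_iff[of J s] S_reflections[of s] by (auto simp: inversions_lw)
  then show ?thesis
    using assms lw_wle_iff[of I "lw J"] by auto
qed

lemma wle_top: "u \<in> carrier W \<Longrightarrow> u \<preceq> lw S"
  using parab_wle_lw[of S u] generate_S by simp

text \<open>Left multiplication by \<open>lw S\<close> keeps the quotient
  \<open>inv u \<otimes> v\<close> and replaces each length by its complement in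
  \<open>len (lw S)\<close>.\<close>

lemma top_mult_wle_iff:
  assumes "u \<in> carrier W" "v \<in> carrier W"
  shows "lw S \<otimes> u \<preceq> lw S \<otimes> v \<longleftrightarrow> v \<preceq> u"
proof -
  have "inv (lw S \<otimes> u) \<otimes> (lw S \<otimes> v) = inv u \<otimes> v"
    using assms by (simp add: inv_mult_group m_assoc)
  moreover have "len (inv u \<otimes> v) = len (inv v \<otimes> u)"
    using len_inv[of "inv u \<otimes> v"] assms by (simp add: inv_mult_group)
  ultimately show ?thesis
    using len_lw_mult[of S u] len_lw_mult[of S v] assms generate_S by (auto simp: wle_def)
qed

subsection \<open>The lattice property of the weak order\<close>

text \<open>
  Bjoerner, Edelman and Ziegler's criterion, by induction on the colength of \<open>z\<close>: if \<open>z s \<preceq> x\<close> and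
  \<open>z t \<preceq> y\<close>, join \<open>x\<close> above \<open>z s\<close> with \<open>w = z w\<^sub>\<circ>\<^sub>,\<^sub>{\<^sub>s\<^sub>,\<^sub>t\<^sub>}\<close>, and the result above \<open>z t\<close> with \<open>y\<close>.
\<close>

lemma weak_join_above:
  assumes "z \<in> carrier W" "x \<in> carrier W" "y \<in> carrier W" "z \<preceq> x" "z \<preceq> y"
  shows "\<exists>j\<in>carrier W. x \<preceq> j \<and> y \<preceq> j \<and> (\<forall>v\<in>carrier W. x \<preceq> v \<longrightarrow> y \<preceq> v \<longrightarrow> j \<preceq> v)"
  using assms
proof (induction "len (lw S) - len z" arbitrary: x y z rule: less_induct)
  case less
  note [simp] = less.prems(1-3)
  consider "z = x" | "z = y" | "z \<noteq> x" "z \<noteq> y" by blast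
  then show ?case
  proof cases
    case 1
    then show ?thesis using less.prems by (intro bexI[of _ y]) auto
  next
    case 2
    then show ?thesis using less.prems by (intro bexI[of _ x]) auto
  next
    case 3
    have atom: "\<exists>s\<in>S. s \<in> inversions (inv z \<otimes> x)" if "x \<in> carrier W" "z \<noteq> x" for x
    proof -
      have "inv z \<otimes> x \<noteq> \<one>"
        using that less.prems(1) by (metis inv_equality inv_closed inv_inv)
      then show ?thesis
        using obtain_left_descent[of "inv z \<otimes> x"] that by (metis S_inversions_iff inv_closed lessI
          less.prems(1) m_closed)
    qed
    obtain s t where s: "s \<in> S" "s \<in> inversions (inv z \<otimes> x)" and t: "t \<in> S" "t \<in> inversions (inv z \<otimes> y)"
      using atom[of x] atom[of y] 3 by auto
    let ?w = "z \<otimes> lw {s, t}"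
    have sub: "{s, t} \<subseteq> S" and [simp]: "?w \<in> carrier W"
      using s t by auto
    have zs: "z \<preceq> z \<otimes> s" "z \<otimes> s \<preceq> x" and zt: "z \<preceq> z \<otimes> t" "z \<otimes> t \<preceq> y"
      using s t less.prems wle_inv_mult_iff[of z x s] wle_inv_mult_iff[of z y t] S_wle_iff[of s]
        S_wle_iff[of t] by auto
    have w_le: "?w \<preceq> v \<and> z \<preceq> ?w" if v: "v \<in> carrier W" "x \<preceq> v" "y \<preceq> v" for v
    proof -
      have zv: "z \<preceq> v"
        using wle_trans[of z x v] less.prems v by simp
      have "s \<preceq> inv z \<otimes> v" "t \<preceq> inv z \<otimes> v"
        using wle_inv_mult_iff[OF zv] zs zt v s t wle_trans[of "z \<otimes> s" x v] wle_trans[of "z \<otimes> t" y v]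
        by auto
      then have "lw {s, t} \<preceq> inv z \<otimes> v"
        using lw_wle_iff[OF sub, of "inv z \<otimes> v"] s t v S_wle_iff by simp
      then show ?thesis
        using wle_inv_mult_iff[OF zv] v sub by simp
    qed
    \<comment> \<open>The second half of \<open>w_le\<close> needs some common upper bound of
      \<open>x\<close> and \<open>y\<close>; the top element serves.\<close>
    have zw: "z \<preceq> ?w"
      using w_le[of "lw S"] wle_top by simp
    have "s \<preceq> lw {s, t}" "t \<preceq> lw {s, t}"
      using parab_wle_lw[OF sub] parab_incl by auto
    then have sw: "z \<otimes> s \<preceq> ?w" and tw: "z \<otimes> t \<preceq> ?w"
      using wle_inv_mult_iff[OF zw] s t sub by auto
    have len: "len (z \<otimes> r) = Suc (len z)" "len (z \<otimes> r) \<le> len (lw S)" if "r \<in> S" "z \<preceq> z \<otimes> r" for r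
      using that lw_max[of S "z \<otimes> r"] generate_S by (auto simp: wle_def)
    have "len (lw S) - len (z \<otimes> s) < len (lw S) - len z"
      using len[OF s(1) zs(1)] by linarith
    from less.hyps[OF this, of x ?w] obtain p where p: "p \<in> carrier W" "x \<preceq> p" "?w \<preceq> p"
      "\<And>v. v \<in> carrier W \<Longrightarrow> x \<preceq> v \<Longrightarrow> ?w \<preceq> v \<Longrightarrow> p \<preceq> v"
      using s(1) zs sw by auto
    have tp: "z \<otimes> t \<preceq> p"
      using wle_trans[OF tw p(3)] t p by simp
    have "len (lw S) - len (z \<otimes> t) < len (lw S) - len z"
      using len[OF t(1) zt(1)] by linarith
    from less.hyps[OF this, of p y] obtain q where q: "q \<in> carrier W" "p \<preceq> q" "y \<preceq> q"
      "\<And>v. v \<in> carrier W \<Longrightarrow> p \<preceq> v \<Longrightarrow> y \<preceq> v \<Longrightarrow> q \<preceq> v"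
      using t(1) zt tp p(1) by auto
    show ?thesis
      using q p w_le wle_trans[of x p q] by (intro bexI[of _ q]) auto
  qed
qed

lemma weak_order_simps [simp]:
  "carrier (weak_order W S) = carrier W" "(.=\<^bsub>weak_order W S\<^esub>) = (=)"
  "u \<sqsubseteq>\<^bsub>weak_order W S\<^esub> v \<longleftrightarrow> u \<preceq> v"
  by (simp_all add: weak_order_def wle_def)

lemma weak_order_partial_order: "partial_order (weak_order W S)"
proof
  show "x \<sqsubseteq>\<^bsub>weak_order W S\<^esub> z" if "x \<sqsubseteq>\<^bsub>weak_order W S\<^esub> y" "y \<sqsubseteq>\<^bsub>weak_order W S\<^esub> z"
    "x \<in> carrier (weak_order W S)" "y \<in> carrier (weak_order W S)" "z \<in> carrier (weak_order W S)"
    for x y z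
    using that wle_trans[of x y z] by simp
  show "x .=\<^bsub>weak_order W S\<^esub> y" if "x \<sqsubseteq>\<^bsub>weak_order W S\<^esub> y" "y \<sqsubseteq>\<^bsub>weak_order W S\<^esub> x"
    "x \<in> carrier (weak_order W S)" "y \<in> carrier (weak_order W S)" for x y
    using that wle_antisym[of x y] by simp
qed auto

lemma weak_join_exists:
  assumes "x \<in> carrier W" "y \<in> carrier W"
  shows "\<exists>j\<in>carrier W. x \<preceq> j \<and> y \<preceq> j \<and> (\<forall>v\<in>carrier W. x \<preceq> v \<longrightarrow> y \<preceq> v \<longrightarrow> j \<preceq> v)"
  by (rule weak_join_above[of \<one>]) (use assms in auto)

text \<open>The meet is the reversal of the join of the reversed elements.\<close>

lemma weak_meet_exists:
  assumes "x \<in> carrier W" "y \<in> carrier W"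
  shows "\<exists>j\<in>carrier W. j \<preceq> x \<and> j \<preceq> y \<and> (\<forall>v\<in>carrier W. v \<preceq> x \<longrightarrow> v \<preceq> y \<longrightarrow> v \<preceq> j)"
proof -
  obtain j where j: "j \<in> carrier W" "lw S \<otimes> x \<preceq> j" "lw S \<otimes> y \<preceq> j"
    "\<And>v. v \<in> carrier W \<Longrightarrow> lw S \<otimes> x \<preceq> v \<Longrightarrow> lw S \<otimes> y \<preceq> v \<Longrightarrow> j \<preceq> v"
    using weak_join_exists[of "lw S \<otimes> x" "lw S \<otimes> y"] assms by auto
  define k where "k = lw S \<otimes> j"
  have k: "k \<in> carrier W" "j = lw S \<otimes> k"
    using j by (simp_all add: k_def)
  have "k \<preceq> x" "k \<preceq> y"
    using j k assms top_mult_wle_iff by metis+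
  moreover have "v \<preceq> k" if v: "v \<in> carrier W" "v \<preceq> x" "v \<preceq> y" for v
    using j(4)[of "lw S \<otimes> v"] v k assms top_mult_wle_iff[of _ v] top_mult_wle_iff[of k v] by simp
  ultimately show ?thesis
    using k by blast
qed

lemma weak_order_lattice: "lattice (weak_order W S)"
proof -
  interpret partial_order "weak_order W S"
    by (rule weak_order_partial_order)
  show ?thesis
  proof
    fix x y assume xy: "x \<in> carrier (weak_order W S)" "y \<in> carrier (weak_order W S)"
    show "\<exists>s. least (weak_order W S) s (Upper (weak_order W S) {x, y})"
    proof -
      obtain j where j: "j \<in> carrier W" "x \<preceq> j" "y \<preceq> j"
        "\<And>v. v \<in> carrier W \<Longrightarrow> x \<preceq> v \<Longrightarrow> y \<preceq> v \<Longrightarrow> j \<preceq> v"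
        using weak_join_exists[of x y] xy by auto
      then show ?thesis
        using xy by (intro exI[of _ j]) (auto simp: least_def Upper_def)
    qed
    show "\<exists>s. greatest (weak_order W S) s (Lower (weak_order W S) {x, y})"
    proof -
      obtain j where j: "j \<in> carrier W" "j \<preceq> x" "j \<preceq> y"
        "\<And>v. v \<in> carrier W \<Longrightarrow> v \<preceq> x \<Longrightarrow> v \<preceq> y \<Longrightarrow> v \<preceq> j"
        using weak_meet_exists[of x y] xy by auto
      then show ?thesis
        using xy by (intro exI[of _ j]) (auto simp: greatest_def Lower_def)
    qed
  qed
qed

section \<open>Conjugation by a longest element, and removing a letter from its type\<close>

text \<open>Multiplying by \<open>lw L\<close> on either side complements lengths within the
  subgroup, so doing both preserves the length one.\<close>

lemma lw_conj_simple:
  assumes "L \<subseteq> S" "s \<in> L"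
  shows "lw L \<otimes> s \<otimes> lw L \<in> L"
proof -
  have s: "s \<in> S" "s \<in> parab L"
    using assms parab_incl by auto
  have p: "s \<otimes> lw L \<in> parab L" "lw L \<otimes> (s \<otimes> lw L) \<in> parab L"
    using s lw_parab[OF assms(1)] parab_mult by auto
  have "len (lw L \<otimes> (s \<otimes> lw L)) = 1"
    using len_lw_mult[OF assms(1) p(1)] len_mult_lw[OF assms(1) s(2)] s by simp
  then have "lw L \<otimes> (s \<otimes> lw L) \<in> S"
    using len_one_S p(2) assms parab_carrier by blast
  then show ?thesis
    using p(2) S_parab_iff[OF assms(1)] s assms(1) by (simp add: m_assoc)
qed

text \<open>
  Let \<open>M\<close> be the set of elements of \<open>L\<close> that are not descents of \<open>y\<close>. Then \<open>y\<^sup>-\<^sup>1 M y \<subseteq> S\<close>, and \<open>L\<close>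
  consists of descents of \<open>y w\<^sub>\<circ>\<close> with \<open>w\<^sub>\<circ>\<close> the longest element generated by \<open>y\<^sup>-\<^sup>1 M y\<close>. So
  a reflection of \<open>W\<^sub>L\<close> that is not an inversion of \<open>y\<close> lies in \<open>W\<^sub>M\<close>, hence in \<open>W\<^sub>L\<^sub>-\<^sub>{\<^sub>s\<^sub>}\<close>.
\<close>

lemma lw_lw_remove_wle:
  assumes "L \<subseteq> S" "J \<subseteq> S" "y \<in> min_reps W S J" "lw L \<preceq> y \<otimes> lw J" "s \<in> L" "s \<in> inversions y"
  shows "lw L \<otimes> lw (L - {lw L \<otimes> s \<otimes> lw L}) \<preceq> y"
proof -
  define r where "r = lw L \<otimes> s \<otimes> lw L"
  have y [simp]: "y \<in> carrier W"
    using assms(3) min_repsD by blast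
  have Lc: "l \<in> S" "l \<in> carrier W" if "l \<in> L" for l
    using that assms(1) by auto
  define M where "M = {l \<in> L. l \<notin> inversions y}"
  define M' where "M' = (\<lambda>l. inv y \<otimes> l \<otimes> y) ` M"
  have M': "inv y \<otimes> l \<otimes> y \<in> S \<and> len y < len (y \<otimes> (inv y \<otimes> l \<otimes> y))" if l: "l \<in> M" for l
  proof -
    have lL: "l \<in> L" "l \<notin> inversions y"
      using l by (auto simp: M_def)
    have "l \<in> inversions (y \<otimes> lw J)"
      using lw_wle_iff[OF assms(1), of "y \<otimes> lw J"] assms lL by auto
    \<comment> \<open>Since \<open>l\<close> is an inversion of \<open>y lw J\<close> but not of
      \<open>y\<close>, the cocycle rule makes its conjugate an inversion of
      \<open>lw J\<close>.\<close>
    then have r: "inv y \<otimes> l \<otimes> y \<in> parab J"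
      using inversions_mult[of l y "lw J"] lL Lc assms inversions_lw by auto
    have eq: "y \<otimes> (inv y \<otimes> l \<otimes> y) = l \<otimes> y"
      using lL Lc by (simp add: m_assoc)
    have "len (l \<otimes> y) = len y + 1"
      using len_S_mult_cases[of l y] lL Lc by (auto simp: S_inversions_iff)
    \<comment> \<open>The element \<open>l y\<close> is \<open>y\<close> times the conjugate of
      \<open>l\<close>, with lengths adding since \<open>y\<close> is minimal, and it is one longer
      than \<open>y\<close>.\<close>
    then have len1: "len (inv y \<otimes> l \<otimes> y) = 1"
      using len_min_rep_mult[OF assms(2,3) r] unfolding eq by simp
    have "inv y \<otimes> l \<otimes> y \<in> S"
      by (rule len_one_S[OF _ len1]) (use lL Lc in simp)
    then show ?thesis
      using \<open>len (l \<otimes> y) = len y + 1\<close> unfolding eq by simp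
  qed
  have M'S: "M' \<subseteq> S"
    using M' by (auto simp: M'_def)
  have yM': "y \<in> min_reps W S M'"
    using M' by (auto simp: min_reps_def M'_def)
  have yle: "y \<preceq> y \<otimes> lw M'"
    using min_rep_wle[OF M'S yM' lw_parab[OF M'S]] .
  have "l \<in> inversions (y \<otimes> lw M')" if l: "l \<in> L" for l
  proof (cases "l \<in> M")
    case True
    then have "inv y \<otimes> l \<otimes> y \<in> M'"
      by (simp add: M'_def)
    then have "inv y \<otimes> l \<otimes> y \<in> inversions (lw M')"
      using M'S parab_incl[of _ M'] S_reflections by (auto simp: inversions_lw[OF M'S])
    then show ?thesis
      using True Lc l M'S by (simp add: inversions_mult M_def)
  next
    case False
    then show ?thesis
      using yle l M'S wle_iff_inversions[of y "y \<otimes> lw M'"] by (auto simp: M_def)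
  qed
  then have "lw L \<preceq> y \<otimes> lw M'"
    using lw_wle_iff[OF assms(1), of "y \<otimes> lw M'"] M'S by auto
  then have cover: "reflections \<inter> parab L \<subseteq> inversions (y \<otimes> lw M')"
    using wle_iff_inversions[of "lw L" "y \<otimes> lw M'"] M'S assms inversions_lw by auto
  have rL: "L - {r} \<subseteq> S"
    using assms by auto
  have "t \<in> inversions y" if t: "t \<in> inversions (lw L \<otimes> lw (L - {r}))" for t
  proof (rule ccontr)
    assume not: "t \<notin> inversions y"
    have tr: "t \<in> reflections"
      using t inversions_subset by blast
    have lwL: "lw L \<in> parab L"
      using lw_parab assms by blast
    \<comment> \<open>By the cocycle rule; since the smaller subgroup lies in
      \<open>parab L\<close>, which conjugation by \<open>lw L\<close> preserves, only one of the
      two alternatives can occur.\<close>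
    have "(t \<in> parab L) \<noteq> (lw L \<otimes> t \<otimes> lw L \<in> parab (L - {r}))"
      using t tr assms(1) rL inversions_mult[of t "lw L" "lw (L - {r})"]
        reflection_conj_inv[of t "lw L"] by (simp add: inversions_lw)
    moreover have "t \<in> parab L" if "lw L \<otimes> t \<otimes> lw L \<in> parab (L - {r})"
    proof -
      have "lw L \<otimes> t \<otimes> lw L \<in> parab L"
        using that mono_generate[of "L - {r}" L] by auto
      then have "lw L \<otimes> (lw L \<otimes> t \<otimes> lw L) \<otimes> lw L \<in> parab L"
        using lwL parab_mult by blast
      then show ?thesis
        using tr assms(1) by (simp add: m_assoc)
    qed
    ultimately have tL: "t \<in> parab L" and nt: "lw L \<otimes> t \<otimes> lw L \<notin> parab (L - {r})"
      by auto
    have "inv y \<otimes> t \<otimes> y \<in> parab M'"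
      using cover tL tr not inversions_mult[of t y "lw M'"] M'S by (auto simp: inversions_lw)
    then have "y \<otimes> (inv y \<otimes> t \<otimes> y) \<otimes> inv y \<in> parab M"
      unfolding M'_def using Lc by (intro generate_conj) (auto simp: M_def)
    then have "t \<in> parab M"
      using tr by (simp add: m_assoc)
    \<comment> \<open>\<open>M\<close> avoids the inversion \<open>s\<close> of \<open>y\<close>,
      and conjugation by \<open>lw L\<close> maps \<open>L - {s}\<close> into
      \<open>L - {r}\<close>.\<close>
    moreover have "M \<subseteq> (\<lambda>l. inv (lw L) \<otimes> l \<otimes> lw L) ` (L - {r})"
    proof
      fix l assume l: "l \<in> M"
      then have lL: "l \<in> L" "l \<noteq> s"
        using assms by (auto simp: M_def)
      have "l = lw L \<otimes> (lw L \<otimes> l \<otimes> lw L) \<otimes> lw L"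
        using lL assms(1) Lc by (simp add: m_assoc)
      moreover have "lw L \<otimes> l \<otimes> lw L \<noteq> r"
        using lL assms(1,5) Lc by (auto simp: r_def)
      ultimately show "l \<in> (\<lambda>l. inv (lw L) \<otimes> l \<otimes> lw L) ` (L - {r})"
        using lw_conj_simple[OF assms(1) lL(1)] assms(1) by auto
    qed
    ultimately have "t \<in> parab ((\<lambda>l. inv (lw L) \<otimes> l \<otimes> lw L) ` (L - {r}))"
      using mono_generate by blast
    then have "lw L \<otimes> t \<otimes> inv (lw L) \<in> parab (L - {r})"
      using Lc assms(1) by (intro generate_conj) auto
    then show False
      using nt assms(1) by simp
  qed
  then show ?thesis
    using wle_iff_inversions[of "lw L \<otimes> lw (L - {r})" y] rL assms(1) unfolding r_def by auto
qed

subsection \<open>Faces\<close>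

lemma coset_bounds:
  assumes "I \<subseteq> S" "x \<in> min_reps W S I" "g \<in> x <# parab I"
  shows "g \<in> carrier W" "x \<preceq> g" "g \<preceq> x \<otimes> lw I"
proof -
  obtain u where u: "u \<in> parab I" "g = x \<otimes> u"
    using assms(3) by (auto simp: l_coset_def)
  have c: "x \<in> carrier W" "u \<in> carrier W"
    using u assms parab_carrier min_repsD by auto
  have "x \<preceq> x \<otimes> lw I"
    using min_rep_wle assms lw_parab by blast
  then have "x \<preceq> x \<otimes> u \<and> x \<otimes> u \<preceq> x \<otimes> lw I"
    using wle_inv_mult_iff[of x "x \<otimes> lw I" u] parab_wle_lw[OF assms(1) u(1)] c assms(1) by simp
  then show "g \<in> carrier W" "x \<preceq> g" "g \<preceq> x \<otimes> lw I"
    using u c by auto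
qed

lemma coset_min_mem: "x \<in> carrier W \<Longrightarrow> x \<in> x <# parab I"
  unfolding l_coset_def using generate.one[of W I] by force

lemma coset_max_mem: "I \<subseteq> S \<Longrightarrow> x \<otimes> lw I \<in> x <# parab I"
  unfolding l_coset_def using lw_parab by blast

lemma wle_min_rep_lw: "I \<subseteq> S \<Longrightarrow> x \<in> min_reps W S I \<Longrightarrow> x \<preceq> x \<otimes> lw I"
  using min_rep_wle lw_parab by blast

text \<open>
  For cosets this compares the minima and the maxima, but it makes sense for all sets and is
  visibly transitive.
\<close>

definition face_le :: "'a set \<Rightarrow> 'a set \<Rightarrow> bool" where
  "face_le F H \<longleftrightarrow> (\<forall>h\<in>H. \<exists>f\<in>F. f \<preceq> h) \<and> (\<forall>f\<in>F. \<exists>h\<in>H. f \<preceq> h)"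

text \<open>Each coset lies between its minimum and its maximum and contains both, so the two halves
  of \<open>face_le\<close> are decided at the minimum of the upper coset and at the maximum of the
  lower one.\<close>

lemma face_le_iff:
  assumes "I \<subseteq> S" "x \<in> min_reps W S I" "J \<subseteq> S" "y \<in> min_reps W S J"
  shows "face_le (x <# parab I) (y <# parab J) \<longleftrightarrow> x \<preceq> y \<and> x \<otimes> lw I \<preceq> y \<otimes> lw J"
proof
  have c: "x \<in> carrier W" "y \<in> carrier W" "x \<otimes> lw I \<in> carrier W" "y \<otimes> lw J \<in> carrier W"
    using assms min_repsD by auto
  {
    assume le: "face_le (x <# parab I) (y <# parab J)"
    then obtain f where f: "f \<in> x <# parab I" "f \<preceq> y"
      using coset_min_mem[of y J] c by (auto simp: face_le_def)
    obtain h where h: "h \<in> y <# parab J" "x \<otimes> lw I \<preceq> h"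
      using le coset_max_mem[OF assms(1), of x] by (auto simp: face_le_def)
    show "x \<preceq> y \<and> x \<otimes> lw I \<preceq> y \<otimes> lw J"
      using wle_trans[of x f y] wle_trans[of "x \<otimes> lw I" h "y \<otimes> lw J"] f h c
        coset_bounds[OF assms(1,2) f(1)] coset_bounds[OF assms(3,4) h(1)] by blast
  }
  {
    assume le: "x \<preceq> y \<and> x \<otimes> lw I \<preceq> y \<otimes> lw J"
    have "x \<preceq> h" if "h \<in> y <# parab J" for h
      using coset_bounds[OF assms(3,4) that] wle_trans[of x y h] le c by blast
    moreover have "f \<preceq> y \<otimes> lw J" if "f \<in> x <# parab I" for f
      using coset_bounds[OF assms(1,2) that] wle_trans[of f "x \<otimes> lw I" "y \<otimes> lw J"] le c by blast
    ultimately show "face_le (x <# parab I) (y <# parab J)"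
      unfolding face_le_def
      using coset_min_mem[of x I] coset_max_mem[OF assms(3), of y] c by blast
  }
qed

lemma face_le_trans:
  assumes "face_le F H" "face_le H K" "F \<subseteq> carrier W" "H \<subseteq> carrier W" "K \<subseteq> carrier W"
  shows "face_le F K"
  unfolding face_le_def
proof (intro conjI ballI)
  fix k assume k: "k \<in> K"
  then obtain h where h: "h \<in> H" "h \<preceq> k"
    using assms(2) by (auto simp: face_le_def)
  then obtain f where f: "f \<in> F" "f \<preceq> h"
    using assms(1) by (auto simp: face_le_def)
  then show "\<exists>f\<in>F. f \<preceq> k"
    using wle_trans[of f h k] h k assms(3-5) by blast
next
  fix f assume f: "f \<in> F"
  then obtain h where h: "h \<in> H" "f \<preceq> h"
    using assms(1) by (auto simp: face_le_def)
  then obtain k where k: "k \<in> K" "h \<preceq> k"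
    using assms(2) by (auto simp: face_le_def)
  then show "\<exists>k\<in>K. f \<preceq> k"
    using wle_trans[of f h k] h f assms(3-5) by blast
qed

lemma min_reps_antimono: "x \<in> min_reps W S I \<Longrightarrow> K \<subseteq> I \<Longrightarrow> x \<in> min_reps W S K"
  by (auto simp: min_reps_def)

text \<open>Seen from the maximum \<open>x lw I\<close>, multiplying by \<open>v\<close> in the
  subgroup of \<open>K\<close> lowers the length by \<open>len v\<close>; the lowest point is
  therefore reached at \<open>v = lw K\<close>.\<close>

lemma lw_lw_min_rep:
  assumes "I \<subseteq> S" "x \<in> min_reps W S I" "K \<subseteq> I"
  shows "x \<otimes> lw I \<otimes> lw K \<in> min_reps W S K"
  unfolding min_reps_def
proof (intro CollectI conjI ballI)
  have x: "x \<in> carrier W" and K: "K \<subseteq> S"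
    using assms min_repsD by auto
  show "x \<otimes> lw I \<otimes> lw K \<in> carrier W"
    using x K assms by simp
  fix s assume s: "s \<in> K"
  have sS: "s \<in> S"
    using s K by auto
  have KI: "v \<in> parab I" if "v \<in> parab K" for v
    using that mono_generate[OF assms(3)] by auto
  have p: "lw K \<in> parab K" "lw K \<otimes> s \<in> parab K"
    using lw_parab[OF K] parab_mult parab_incl[OF s] by auto
  have len: "len (x \<otimes> (lw I \<otimes> v)) + len v = len x + len (lw I)" if "v \<in> parab K" for v
    using len_min_rep_mult[OF assms(1,2), of "lw I \<otimes> v"] len_lw_mult[OF assms(1) KI[OF that]]
      parab_mult[OF lw_parab[OF assms(1)] KI[OF that]] by simp
  have "len (lw K \<otimes> s) < len (lw K)"
    using len_lw_mult[OF K parab_incl[OF s]] sS by simp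
  then have "len (x \<otimes> (lw I \<otimes> lw K)) < len (x \<otimes> (lw I \<otimes> (lw K \<otimes> s)))"
    using len[OF p(1)] len[OF p(2)] by linarith
  then show "len (x \<otimes> lw I \<otimes> lw K) < len (x \<otimes> lw I \<otimes> lw K \<otimes> s)"
    using x K assms sS by (simp add: m_assoc)
qed

lemma parabolic_cosetE:
  assumes "F \<in> parabolic_cosets W S"
  obtains x I where "I \<subseteq> S" "x \<in> min_reps W S I" "F = x <# parab I"
proof -
  obtain g I where g: "g \<in> carrier W" "I \<subseteq> S" "F = g <# parab I"
    using assms by (auto simp: parabolic_cosets_def)
  obtain x v where x: "x \<in> min_reps W S I" "v \<in> parab I" "g = x \<otimes> v"
    by (rule min_rep_decomp[OF g(2,1)])
  have "g \<in> x <# parab I"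
    using x by (auto simp: l_coset_def)
  then have "x <# parab I = g <# parab I"
    using l_repr_independence[of g x "parab I"] parab_subgroup[OF g(2)] min_repsD[OF x(1)] by simp
  then show thesis
    using that[of I x] g x by simp
qed

lemma parabolic_cosetI: "I \<subseteq> S \<Longrightarrow> x \<in> carrier W \<Longrightarrow> x <# parab I \<in> parabolic_cosets W S"
  by (auto simp: parabolic_cosets_def)

lemma parabolic_coset_carrier: "F \<in> parabolic_cosets W S \<Longrightarrow> F \<subseteq> carrier W"
  by (metis parabolic_cosetE coset_bounds(1) subsetI)

text \<open>A cover of the first kind keeps the minimum and raises the maximum; one of the second
  kind keeps the maximum and raises the minimum.\<close>

lemma facial_cover_face_le:
  assumes "facial_cover W S F H"
  shows "F \<in> parabolic_cosets W S \<and> H \<in> parabolic_cosets W S \<and> face_le F H"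
  using assms
proof cases
  case (up I x s)
  have c: "x \<in> carrier W" "I \<union> {s} \<subseteq> S"
    using up min_repsD by auto
  have "lw I \<preceq> lw (I \<union> {s})"
    using lw_mono_iff[of I "I \<union> {s}"] up c by auto
  then have "x \<otimes> lw I \<preceq> x \<otimes> lw (I \<union> {s})"
    using wle_inv_mult_iff[OF wle_min_rep_lw[OF c(2) up(7)], of "lw I"] c up by simp
  then show ?thesis
    using face_le_iff[of I x "I \<union> {s}" x] c up parabolic_cosetI by simp
next
  case (down I x s)
  have K: "I - {s} \<subseteq> S" "I - {s} \<subseteq> I"
    using down by auto
  let ?y = "x \<otimes> lw I \<otimes> lw (I - {s})"
  have c: "x \<in> carrier W" "?y \<in> carrier W"
    using down K min_repsD by auto
  have y: "?y \<in> min_reps W S (I - {s})"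
    using lw_lw_min_rep[OF down(3,4) K(2)] .
  have "lw I \<otimes> lw (I - {s}) \<in> parab I"
    using lw_parab[OF down(3)] lw_parab[OF K(1)] mono_generate[OF K(2)] parab_mult by blast
  then have "x \<preceq> ?y"
    using min_rep_wle[OF down(3,4)] c K down by (simp add: m_assoc)
  moreover have "?y \<otimes> lw (I - {s}) = x \<otimes> lw I"
    using c K down by (simp add: m_assoc)
  ultimately show ?thesis
    using face_le_iff[OF down(3,4) K(1) y] c K down parabolic_cosetI by simp
qed

text \<open>The missing letters are added one at a time, by covers of the first kind only;
  \<open>y\<close> stays minimal for every subset of \<open>J\<close>.\<close>

lemma facial_up_chain:
  assumes "J \<subseteq> S" "y \<in> min_reps W S J" "L \<subseteq> J"
  shows "(facial_cover W S)\<^sup>*\<^sup>* (y <# parab L) (y <# parab J)"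
proof -
  have "finite (J - L)"
    using assms S_subset finite_carrier by (meson finite_Diff finite_subset)
  then have "(facial_cover W S)\<^sup>*\<^sup>* (y <# parab L) (y <# parab (L \<union> K))" if "K \<subseteq> J - L" for K
  proof -
    have "finite K"
      using that \<open>finite (J - L)\<close> finite_subset by blast
    then show ?thesis
      using that
    proof (induction K rule: finite_induct)
      case (insert s K)
      have sub: "(L \<union> K) \<union> {s} \<subseteq> J"
        using insert assms by auto
      have "facial_cover W S (y <# parab (L \<union> K)) (y <# parab ((L \<union> K) \<union> {s}))"
        by (rule facial_cover.up)
          (use sub insert assms min_reps_antimono[OF assms(2) sub] min_reps_antimono[OF assms(2), of "L \<union> K"] in auto)
      then show ?case
        using insert by (simp add: rtranclp.rtrancl_into_rtrancl)
    qed simp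
  qed
  from this[of "J - L"] show ?thesis
    using assms by (simp add: Un_absorb1)
qed

section \<open>Climbing along covers below given faces\<close>

text \<open>As \<open>u\<close> lies below both \<open>y\<close> and \<open>y s\<close>, splitting
  it off lowers both lengths by \<open>len u\<close>.\<close>

lemma min_reps_translate:
  assumes "J \<subseteq> S" "y \<in> min_reps W S J" "u \<in> carrier W" "u \<preceq> y"
  shows "inv u \<otimes> y \<in> min_reps W S J"
  unfolding min_reps_def
proof (intro CollectI conjI ballI)
  have y: "y \<in> carrier W"
    using assms min_repsD by blast
  then show "inv u \<otimes> y \<in> carrier W"
    using assms by simp
  fix s assume s: "s \<in> J"
  have sS: "s \<in> S"
    using s assms by auto
  have "u \<preceq> y \<otimes> s"
    using wle_trans[OF assms(4) min_rep_wle[OF assms(1,2) parab_incl[OF s]]] y sS assms by simp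
  moreover have "len y < len (y \<otimes> s)"
    using assms s by (auto simp: min_reps_def)
  ultimately show "len (inv u \<otimes> y) < len (inv u \<otimes> y \<otimes> s)"
    using assms(3,4) y sS by (simp add: wle_def m_assoc)
qed

lemma obtain_simple_wle:
  assumes "u \<in> carrier W" "z \<in> carrier W" "u \<preceq> z" "u \<noteq> z"
  obtains s where "s \<in> S" "u \<preceq> u \<otimes> s" "u \<otimes> s \<preceq> z"
proof -
  have "inv u \<otimes> z \<noteq> \<one>"
    using assms by (metis inv_equality inv_closed inv_inv)
  then obtain s where s: "s \<in> S" "len (inv u \<otimes> z) = Suc (len (s \<otimes> (inv u \<otimes> z)))"
    using obtain_left_descent[of "inv u \<otimes> z"] assms by auto
  then have "s \<preceq> inv u \<otimes> z"
    using assms S_wle_iff[of s "inv u \<otimes> z"] by (simp add: S_inversions_iff)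
  then show thesis
    using that[of s] wle_inv_mult_iff[OF assms(3)] assms s by simp
qed

text \<open>The letters of \<open>L\<close> and \<open>s\<close> are all left descents of
  \<open>inv u \<otimes> (y \<otimes> lw J)\<close>, and by \<open>lw_wle_iff\<close> a set of left
  descents forces its longest element below.\<close>

lemma face_step_up:
  assumes "L \<subseteq> S" "u \<in> min_reps W S L" "J \<subseteq> S" "y \<in> min_reps W S J"
    and le: "u \<preceq> y" "u \<otimes> lw L \<preceq> y \<otimes> lw J"
    and s: "s \<in> S" "u \<preceq> u \<otimes> s" "u \<otimes> s \<preceq> y"
  shows "u \<otimes> lw (L \<union> {s}) \<preceq> y \<otimes> lw J"
proof -
  have c: "u \<in> carrier W" "y \<in> carrier W" "y \<otimes> lw J \<in> carrier W" "L \<union> {s} \<subseteq> S"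
    using assms min_repsD by auto
  have yY: "y \<preceq> y \<otimes> lw J"
    using wle_min_rep_lw assms by blast
  have uY: "u \<preceq> y \<otimes> lw J" "u \<otimes> s \<preceq> y \<otimes> lw J"
    using wle_trans[OF le(1) yY] wle_trans[OF s(3) yY] c s by auto
  note iff = wle_inv_mult_iff[OF uY(1) c(1) _ c(3)]
  have "lw L \<preceq> inv u \<otimes> (y \<otimes> lw J)"
    using iff[of "lw L"] le wle_min_rep_lw[OF assms(1,2)] assms(1) by simp
  then have "L \<subseteq> inversions (inv u \<otimes> (y \<otimes> lw J))"
    using lw_wle_iff[OF assms(1)] c by simp
  moreover have "s \<in> inversions (inv u \<otimes> (y \<otimes> lw J))"
    using iff[of s] s uY c S_wle_iff[of s "inv u \<otimes> (y \<otimes> lw J)"] by simp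
  ultimately have "lw (L \<union> {s}) \<preceq> inv u \<otimes> (y \<otimes> lw J)"
    using lw_wle_iff[OF c(4)] c by simp
  then show ?thesis
    using iff[of "lw (L \<union> {s})"] c(4) by simp
qed

text \<open>Translation by \<open>inv u\<close> reduces this to \<open>lw_lw_remove_wle\<close> for
  \<open>inv u \<otimes> y\<close>, which is still minimal for \<open>J\<close> and has
  \<open>s\<close> as a left descent.\<close>

lemma face_step_down:
  assumes "L \<subseteq> S" "u \<in> min_reps W S L" "J \<subseteq> S" "y \<in> min_reps W S J"
    and le: "u \<preceq> y" "u \<otimes> lw L \<preceq> y \<otimes> lw J"
    and s: "s \<in> L" "u \<preceq> u \<otimes> s" "u \<otimes> s \<preceq> y"
  shows "u \<otimes> lw L \<otimes> lw (L - {lw L \<otimes> s \<otimes> lw L}) \<preceq> y"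
proof -
  let ?L = "L - {lw L \<otimes> s \<otimes> lw L}"
  have c: "u \<in> carrier W" "y \<in> carrier W" "y \<otimes> lw J \<in> carrier W" "?L \<subseteq> S" "s \<in> S"
    using assms min_repsD by auto
  have uY: "u \<preceq> y \<otimes> lw J"
    using wle_trans[OF le(1) wle_min_rep_lw[OF assms(3,4)]] c by auto
  have "lw L \<preceq> inv u \<otimes> (y \<otimes> lw J)"
    using wle_inv_mult_iff[OF uY c(1) _ c(3), of "lw L"] le wle_min_rep_lw[OF assms(1,2)] assms(1)
    by simp
  then have "lw L \<preceq> inv u \<otimes> y \<otimes> lw J"
    using c assms by (simp add: m_assoc)
  moreover have "s \<in> inversions (inv u \<otimes> y)"
    using wle_inv_mult_iff[OF le(1), of s] s c S_wle_iff[of s "inv u \<otimes> y"] by simp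
  ultimately have "lw L \<otimes> lw ?L \<preceq> inv u \<otimes> y"
    using lw_lw_remove_wle[OF assms(1,3) min_reps_translate[OF assms(3,4) c(1) le(1)]] s(1) by blast
  then have "u \<otimes> (lw L \<otimes> lw ?L) \<preceq> y"
    using wle_inv_mult_iff[OF le(1), of "lw L \<otimes> lw ?L"] c assms(1) by simp
  then show ?thesis
    using c assms(1) by (simp add: m_assoc)
qed

text \<open>The path has to stay below two faces at once. With equal targets the lemma shows that
  comparing minima and maxima implies the facial order; with two targets it handles arbitrary lower
  bounds of a pair.\<close>

lemma climb_to_meet:
  assumes "J1 \<subseteq> S" "y1 \<in> min_reps W S J1" "J2 \<subseteq> S" "y2 \<in> min_reps W S J2"
    and z: "z \<in> carrier W" "z \<preceq> y1" "z \<preceq> y2"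
      "\<And>v. v \<in> carrier W \<Longrightarrow> v \<preceq> y1 \<Longrightarrow> v \<preceq> y2 \<Longrightarrow> v \<preceq> z"
    and L: "L \<subseteq> S" "u \<in> min_reps W S L"
    and le: "u \<preceq> y1" "u \<otimes> lw L \<preceq> y1 \<otimes> lw J1" "u \<preceq> y2" "u \<otimes> lw L \<preceq> y2 \<otimes> lw J2"
  shows "\<exists>K\<subseteq>S. z \<in> min_reps W S K \<and> (facial_cover W S)\<^sup>*\<^sup>* (u <# parab L) (z <# parab K) \<and>
    z \<otimes> lw K \<preceq> y1 \<otimes> lw J1 \<and> z \<otimes> lw K \<preceq> y2 \<otimes> lw J2"
  using L le
\<comment> \<open>The lengths of the minimum and the maximum add up to at most
  \<open>2 * len (lw S)\<close>, and the sum grows with every cover.\<close>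
proof (induction "2 * len (lw S) - (len u + len (u \<otimes> lw L))" arbitrary: u L rule: less_induct)
  case less
  have y: "y1 \<in> carrier W" "y2 \<in> carrier W"
    using assms min_repsD by auto
  have u [simp]: "u \<in> carrier W"
    using less.prems min_repsD by blast
  have bound: "len v \<le> len (lw S)" if "v \<in> carrier W" for v
    using lw_max[of S v] generate_S that by simp
  have uz: "u \<preceq> z"
    using z less.prems u by blast
  show ?case
  proof (cases "u = z")
    case True
    then show ?thesis
      using less.prems by (intro exI[of _ L]) auto
  next
    case False
    then obtain s where s: "s \<in> S" "u \<preceq> u \<otimes> s" "u \<otimes> s \<preceq> z"
      using obtain_simple_wle[OF u z(1) uz] by blast
    have us: "u \<otimes> s \<preceq> y1" "u \<otimes> s \<preceq> y2"
      using wle_trans[OF s(3) z(2)] wle_trans[OF s(3) z(3)] s y z by auto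
    show ?thesis
    proof (cases "s \<in> L")
      case sL: False
      let ?L = "L \<union> {s}"
      have L': "?L \<subseteq> S"
        using less.prems s by auto
      have uL': "u \<in> min_reps W S ?L"
        using less.prems s by (auto simp: min_reps_def wle_def)
      have cov: "facial_cover W S (u <# parab L) (u <# parab ?L)"
        by (rule facial_cover.up) (use less.prems s sL uL' in auto)
      \<comment> \<open>The minimum stays \<open>u\<close>, so the measure has to drop through the
        maximum: otherwise the two longest elements, hence the two types, would agree.\<close>
      have "\<not> len (lw ?L) \<le> len (lw L)"
      proof
        assume "len (lw ?L) \<le> len (lw L)"
        moreover have "lw L \<preceq> lw ?L"
          using lw_mono_iff[of L ?L] less.prems L' by auto
        ultimately have "lw L = lw ?L"
          using wle_len_eq[of "lw L" "lw ?L"] less.prems L' by simp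
        then have "lw ?L \<preceq> lw L"
          using wle_refl[OF lw_carrier[OF L']] by metis
        then have "?L \<subseteq> L"
          using lw_mono_iff[OF L' less.prems(1)] by blast
        then show False
          using sL by blast
      qed
      then have "len (u \<otimes> lw L) < len (u \<otimes> lw ?L)"
        using len_min_rep_mult[OF less.prems(1,2) lw_parab[OF less.prems(1)]]
          len_min_rep_mult[OF L' uL' lw_parab[OF L']] by simp
      then have "2 * len (lw S) - (len u + len (u \<otimes> lw ?L)) < 2 * len (lw S) - (len u + len (u \<otimes> lw L))"
        using bound[of u] bound[of "u \<otimes> lw ?L"] L' by simp
      from less.hyps[OF this L' uL'] obtain K where
        "K \<subseteq> S" "z \<in> min_reps W S K" "(facial_cover W S)\<^sup>*\<^sup>* (u <# parab ?L) (z <# parab K)"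
        "z \<otimes> lw K \<preceq> y1 \<otimes> lw J1" "z \<otimes> lw K \<preceq> y2 \<otimes> lw J2"
        using less.prems face_step_up[OF less.prems(1,2) assms(1,2) less.prems(3,4) s(1,2) us(1)]
          face_step_up[OF less.prems(1,2) assms(3,4) less.prems(5,6) s(1,2) us(2)] by auto
      then show ?thesis
        using cov converse_rtranclp_into_rtranclp[of "facial_cover W S"] by blast
    next
      case sL: True
      \<comment> \<open>Among the upper facets of the face, removing \<open>r\<close> gives the one
        whose minimum lies above \<open>u s\<close>: for \<open>k\<close> in \<open>L\<close>,
        \<open>s\<close> is an inversion of \<open>lw L \<otimes> lw (L - {k})\<close> only if
        \<open>k = r\<close>.\<close>
      define r where "r = lw L \<otimes> s \<otimes> lw L"
      have r: "r \<in> L"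
        using lw_conj_simple[OF less.prems(1) sL] by (simp add: r_def)
      let ?L = "L - {r}"
      let ?u = "u \<otimes> lw L \<otimes> lw ?L"
      have L': "?L \<subseteq> S" "?L \<subseteq> L"
        using less.prems by auto
      have uL': "?u \<in> min_reps W S ?L"
        using lw_lw_min_rep[OF less.prems(1,2) L'(2)] .
      have cov: "facial_cover W S (u <# parab L) (?u <# parab ?L)"
        by (rule facial_cover.down) (use less.prems r in auto)
      \<comment> \<open>As \<open>lw ?L\<close> is an involution, the maximum is unchanged and its
        bounds carry over; only the minimum rises.\<close>
      have top: "?u \<otimes> lw ?L = u \<otimes> lw L"
        using less.prems L' by (simp add: m_assoc)
      have "lw L \<otimes> lw ?L \<noteq> \<one>"
      proof
        assume "lw L \<otimes> lw ?L = \<one>"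
        then have "lw L = lw ?L"
          using less.prems L' by (metis inv_equality lw_carrier lw_inv)
        then have "lw L \<preceq> lw ?L"
          using wle_refl[OF lw_carrier[OF L'(1)]] by metis
        then have "L \<subseteq> ?L"
          using lw_mono_iff[OF less.prems(1) L'(1)] by blast
        then show False
          using r by blast
      qed
      moreover have pL: "lw L \<otimes> lw ?L \<in> parab L"
        using lw_parab[OF less.prems(1)] lw_parab[OF L'(1)] mono_generate[OF L'(2)] parab_mult by blast
      ultimately have "len u < len ?u"
        using len_min_rep_mult[OF less.prems(1,2) pL] len_zero_iff[of "lw L \<otimes> lw ?L"] less.prems L'
        by (simp add: m_assoc)
      then have "2 * len (lw S) - (len ?u + len (?u \<otimes> lw ?L)) < 2 * len (lw S) - (len u + len (u \<otimes> lw L))"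
        using bound[of ?u] bound[of "u \<otimes> lw L"] L' less.prems unfolding top by simp
      from less.hyps[OF this L'(1) uL'] obtain K where
        "K \<subseteq> S" "z \<in> min_reps W S K" "(facial_cover W S)\<^sup>*\<^sup>* (?u <# parab ?L) (z <# parab K)"
        "z \<otimes> lw K \<preceq> y1 \<otimes> lw J1" "z \<otimes> lw K \<preceq> y2 \<otimes> lw J2"
        using face_step_down[OF less.prems(1,2) assms(1,2) less.prems(3,4) sL s(2) us(1)]
          face_step_down[OF less.prems(1,2) assms(3,4) less.prems(5,6) sL s(2) us(2)] less.prems
        unfolding top r_def[symmetric] by auto
      then show ?thesis
        using cov converse_rtranclp_into_rtranclp[of "facial_cover W S"] by blast
    qed
  qed
qed

subsection \<open>Meets and joins of faces\<close>

lemma facial_iff_face_le: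
  assumes "F \<in> parabolic_cosets W S" "H \<in> parabolic_cosets W S"
  shows "(facial_cover W S)\<^sup>*\<^sup>* F H \<longleftrightarrow> face_le F H"
proof
  assume "(facial_cover W S)\<^sup>*\<^sup>* F H"
  then show "face_le F H"
  proof (induction rule: rtranclp_induct)
    case base
    have "\<forall>f\<in>F. f \<preceq> f"
      using parabolic_coset_carrier[OF assms(1)] by auto
    then show ?case
      unfolding face_le_def by blast
  next
    case (step K H)
    then show ?case
      using facial_cover_face_le[OF step.hyps(2)] face_le_trans parabolic_coset_carrier assms(1)
      by blast
  qed
next
  assume le: "face_le F H"
  obtain x I where F: "I \<subseteq> S" "x \<in> min_reps W S I" "F = x <# parab I"
    by (rule parabolic_cosetE[OF assms(1)])
  obtain y J where H: "J \<subseteq> S" "y \<in> min_reps W S J" "H = y <# parab J"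
    by (rule parabolic_cosetE[OF assms(2)])
  have y: "y \<in> carrier W"
    using H min_repsD by blast
  have le': "x \<preceq> y" "x \<otimes> lw I \<preceq> y \<otimes> lw J"
    using le face_le_iff[OF F(1,2) H(1,2)] F H by auto
  \<comment> \<open>Both targets are \<open>H\<close>, so the meet is \<open>y\<close> itself and
    the climb ends at minimum \<open>y\<close>; only the type may still have to grow.\<close>
  obtain K where K: "K \<subseteq> S" "y \<in> min_reps W S K" "(facial_cover W S)\<^sup>*\<^sup>* F (y <# parab K)"
    "y \<otimes> lw K \<preceq> y \<otimes> lw J"
    using climb_to_meet[OF H(1,2) H(1,2) y wle_refl[OF y] wle_refl[OF y] _ F(1,2) le' le'] F(3) by auto
  have "lw K \<preceq> lw J"
    using K wle_inv_mult_iff[OF wle_min_rep_lw[OF H(1,2)], of "lw K"] wle_min_rep_lw[OF K(1,2)] y H(1)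
    by simp
  then have "K \<subseteq> J"
    using lw_mono_iff[OF K(1) H(1)] by blast
  then show "(facial_cover W S)\<^sup>*\<^sup>* F H"
    using facial_up_chain[OF H(1,2)] K(3) H(3) rtranclp_trans[of "facial_cover W S"] by blast
qed

lemma facial_weak_order_simps [simp]:
  "carrier (facial_weak_order W S) = parabolic_cosets W S"
  "(.=\<^bsub>facial_weak_order W S\<^esub>) = (=)"
  "F \<in> parabolic_cosets W S \<Longrightarrow> H \<in> parabolic_cosets W S \<Longrightarrow>
    F \<sqsubseteq>\<^bsub>facial_weak_order W S\<^esub> H \<longleftrightarrow> face_le F H"
  by (simp_all add: facial_weak_order_def facial_iff_face_le)

text \<open>Equal minima and maxima give \<open>lw I = lw J\<close>, and a longest element
  determines its type.\<close>

lemma face_le_antisym: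
  assumes "face_le F H" "face_le H F" "F \<in> parabolic_cosets W S" "H \<in> parabolic_cosets W S"
  shows "F = H"
proof -
  obtain x I where F: "I \<subseteq> S" "x \<in> min_reps W S I" "F = x <# parab I"
    by (rule parabolic_cosetE[OF assms(3)])
  obtain y J where H: "J \<subseteq> S" "y \<in> min_reps W S J" "H = y <# parab J"
    by (rule parabolic_cosetE[OF assms(4)])
  have c: "x \<in> carrier W" "y \<in> carrier W"
    using F H min_repsD by auto
  have "x = y" and top: "x \<otimes> lw I = y \<otimes> lw J"
    using assms(1,2) face_le_iff[OF F(1,2) H(1,2)] face_le_iff[OF H(1,2) F(1,2)] F H c
    by (auto intro!: wle_antisym)
  then have "lw I = lw J"
    using c F H by simp
  then have "lw I \<preceq> lw J" "lw J \<preceq> lw I"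
    using wle_refl[OF lw_carrier[OF H(1)]] by auto
  then have "I = J"
    using lw_mono_iff[OF F(1) H(1)] lw_mono_iff[OF H(1) F(1)] by blast
  then show ?thesis
    using F H \<open>x = y\<close> by simp
qed

lemma facial_partial_order: "partial_order (facial_weak_order W S)"
proof
  fix F H assume *: "F \<sqsubseteq>\<^bsub>facial_weak_order W S\<^esub> H" "H \<sqsubseteq>\<^bsub>facial_weak_order W S\<^esub> F"
    "F \<in> carrier (facial_weak_order W S)" "H \<in> carrier (facial_weak_order W S)"
  then show "F .=\<^bsub>facial_weak_order W S\<^esub> H"
    using face_le_antisym[of F H] by simp
next
  fix F H K assume *: "F \<sqsubseteq>\<^bsub>facial_weak_order W S\<^esub> H" "H \<sqsubseteq>\<^bsub>facial_weak_order W S\<^esub> K"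
    "F \<in> carrier (facial_weak_order W S)" "H \<in> carrier (facial_weak_order W S)"
    "K \<in> carrier (facial_weak_order W S)"
  then show "F \<sqsubseteq>\<^bsub>facial_weak_order W S\<^esub> K"
    using face_le_trans[of F H K] parabolic_coset_carrier by simp
qed (auto simp: facial_weak_order_def)

abbreviation wmeet (infixl \<open>\<and>\<^sub>w\<close> 70) where
  "u \<and>\<^sub>w v \<equiv> u \<sqinter>\<^bsub>weak_order W S\<^esub> v"

abbreviation wjoin (infixl \<open>\<or>\<^sub>w\<close> 65) where
  "u \<or>\<^sub>w v \<equiv> u \<squnion>\<^bsub>weak_order W S\<^esub> v"

lemma wmeet:
  assumes "x \<in> carrier W" "y \<in> carrier W"
  shows "x \<and>\<^sub>w y \<in> carrier W" "x \<and>\<^sub>w y \<preceq> x" "x \<and>\<^sub>w y \<preceq> y"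
    "\<And>v. v \<in> carrier W \<Longrightarrow> v \<preceq> x \<Longrightarrow> v \<preceq> y \<Longrightarrow> v \<preceq> x \<and>\<^sub>w y"
proof -
  interpret wo: lattice "weak_order W S"
    by (rule weak_order_lattice)
  show "x \<and>\<^sub>w y \<in> carrier W" "x \<and>\<^sub>w y \<preceq> x" "x \<and>\<^sub>w y \<preceq> y"
    "\<And>v. v \<in> carrier W \<Longrightarrow> v \<preceq> x \<Longrightarrow> v \<preceq> y \<Longrightarrow> v \<preceq> x \<and>\<^sub>w y"
    using wo.meet_closed[of x y] wo.meet_left[of x y] wo.meet_right[of x y] wo.meet_le[of _ x y] assms
    by auto
qed

lemma wjoin:
  assumes "x \<in> carrier W" "y \<in> carrier W"
  shows "x \<or>\<^sub>w y \<in> carrier W" "x \<preceq> x \<or>\<^sub>w y" "y \<preceq> x \<or>\<^sub>w y"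
    "\<And>v. v \<in> carrier W \<Longrightarrow> x \<preceq> v \<Longrightarrow> y \<preceq> v \<Longrightarrow> x \<or>\<^sub>w y \<preceq> v"
proof -
  interpret wo: lattice "weak_order W S"
    by (rule weak_order_lattice)
  show "x \<or>\<^sub>w y \<in> carrier W" "x \<preceq> x \<or>\<^sub>w y" "y \<preceq> x \<or>\<^sub>w y"
    "\<And>v. v \<in> carrier W \<Longrightarrow> x \<preceq> v \<Longrightarrow> y \<preceq> v \<Longrightarrow> x \<or>\<^sub>w y \<preceq> v"
    using wo.join_closed[of x y] wo.join_left[of x y] wo.join_right[of x y] wo.join_le[of x _ y] assms
    by auto
qed

lemma top_mult_wjoin:
  assumes "x \<in> carrier W" "y \<in> carrier W"
  shows "(lw S \<otimes> x) \<and>\<^sub>w (lw S \<otimes> y) = lw S \<otimes> (x \<or>\<^sub>w y)"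
proof (rule wle_antisym)
  let ?m = "(lw S \<otimes> x) \<and>\<^sub>w (lw S \<otimes> y)"
  have m: "?m \<in> carrier W" "?m \<preceq> lw S \<otimes> x" "?m \<preceq> lw S \<otimes> y"
    using wmeet[of "lw S \<otimes> x" "lw S \<otimes> y"] assms by auto
  show "?m \<in> carrier W" "lw S \<otimes> (x \<or>\<^sub>w y) \<in> carrier W"
    using m wjoin assms by auto
  have eq: "?m = lw S \<otimes> (lw S \<otimes> ?m)"
    using m by simp
  have "x \<preceq> lw S \<otimes> ?m" "y \<preceq> lw S \<otimes> ?m"
    using m assms top_mult_wle_iff[of "lw S \<otimes> ?m"] by auto
  then have "x \<or>\<^sub>w y \<preceq> lw S \<otimes> ?m"
    using wjoin(4)[OF assms] m by simp
  then show "?m \<preceq> lw S \<otimes> (x \<or>\<^sub>w y)"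
    using top_mult_wle_iff[of "lw S \<otimes> ?m" "x \<or>\<^sub>w y"] m wjoin(1)[OF assms] by simp
  show "lw S \<otimes> (x \<or>\<^sub>w y) \<preceq> ?m"
    using assms wjoin[OF assms] wmeet(4)[of "lw S \<otimes> x" "lw S \<otimes> y" "lw S \<otimes> (x \<or>\<^sub>w y)"]
      top_mult_wle_iff by simp
qed

abbreviation meet_type :: "'a \<Rightarrow> 'a set \<Rightarrow> 'a \<Rightarrow> 'a set \<Rightarrow> 'a set" where
  "meet_type x I y J \<equiv> left_descents W S (inv (x \<and>\<^sub>w y) \<otimes> ((x \<otimes> lw I) \<and>\<^sub>w (y \<otimes> lw J)))"

text \<open>Write \<open>z\<close> for the meet of the minima and \<open>Z\<close> for that of the
  maxima. A face with minimum \<open>z\<close> and type \<open>M\<close> is a lower bound iff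
  \<open>z lw M\<close> is below \<open>Z\<close>, that is, iff \<open>M\<close> consists of left
  descents of \<open>inv z Z\<close>; so \<open>K\<close> is the largest possible type. Any other
  lower bound first climbs to one with minimum \<open>z\<close>.\<close>

lemma face_meet:
  assumes "I \<subseteq> S" "x \<in> min_reps W S I" "J \<subseteq> S" "y \<in> min_reps W S J"
  defines "K \<equiv> meet_type x I y J"
  shows "K \<subseteq> S" "x \<and>\<^sub>w y \<in> min_reps W S K"
    "face_le ((x \<and>\<^sub>w y) <# parab K) (x <# parab I)"
    "face_le ((x \<and>\<^sub>w y) <# parab K) (y <# parab J)"
    "\<And>F. F \<in> parabolic_cosets W S \<Longrightarrow> face_le F (x <# parab I) \<Longrightarrow> face_le F (y <# parab J) \<Longrightarrow>
      face_le F ((x \<and>\<^sub>w y) <# parab K)"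
proof -
  let ?z = "x \<and>\<^sub>w y" and ?Z = "(x \<otimes> lw I) \<and>\<^sub>w (y \<otimes> lw J)"
  have c: "x \<in> carrier W" "y \<in> carrier W" "x \<otimes> lw I \<in> carrier W" "y \<otimes> lw J \<in> carrier W"
    using assms min_repsD by auto
  note z = wmeet[OF c(1,2)] and Z = wmeet[OF c(3,4)]
  have "?z \<preceq> x \<otimes> lw I" "?z \<preceq> y \<otimes> lw J"
    using wle_trans[OF z(2) wle_min_rep_lw[OF assms(1,2)]] wle_trans[OF z(3) wle_min_rep_lw[OF assms(3,4)]]
      z c by auto
  then have zZ: "?z \<preceq> ?Z"
    using Z z by blast
  note iff = wle_inv_mult_iff[OF zZ z(1) _ Z(1)]
  have K: "K = S \<inter> inversions (inv ?z \<otimes> ?Z)"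
    by (simp add: K_def left_descents_eq)
  show KS: "K \<subseteq> S"
    using K by blast
  have below: "lw L \<preceq> inv ?z \<otimes> ?Z \<longleftrightarrow> L \<subseteq> K" if "L \<subseteq> S" for L
    using lw_wle_iff[OF that, of "inv ?z \<otimes> ?Z"] z Z that K by auto
  have zK: "?z \<otimes> lw K \<preceq> ?Z"
    using below[OF KS] iff[of "lw K"] KS by simp
  show min: "?z \<in> min_reps W S K"
    unfolding min_reps_def
  proof (intro CollectI conjI ballI)
    fix s assume "s \<in> K"
    then have s: "s \<in> S" "s \<preceq> inv ?z \<otimes> ?Z"
      using K z Z S_wle_iff by auto
    then have "?z \<preceq> ?z \<otimes> s"
      using iff[of s] by simp
    then show "len ?z < len (?z \<otimes> s)"
      using s z by (simp add: wle_def)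
  qed (rule z(1))
  have zKc: "?z \<otimes> lw K \<in> carrier W"
    using z KS by simp
  show "face_le (?z <# parab K) (x <# parab I)" "face_le (?z <# parab K) (y <# parab J)"
    using face_le_iff[OF KS min assms(1,2)] face_le_iff[OF KS min assms(3,4)] z
      wle_trans[OF zK Z(2) zKc Z(1) c(3)] wle_trans[OF zK Z(3) zKc Z(1) c(4)] by auto
  fix F assume F: "F \<in> parabolic_cosets W S" "face_le F (x <# parab I)" "face_le F (y <# parab J)"
  obtain u L where u: "L \<subseteq> S" "u \<in> min_reps W S L" "F = u <# parab L"
    by (rule parabolic_cosetE[OF F(1)])
  have le: "u \<preceq> x" "u \<otimes> lw L \<preceq> x \<otimes> lw I" "u \<preceq> y" "u \<otimes> lw L \<preceq> y \<otimes> lw J"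
    using F u face_le_iff assms by auto
  obtain M where M: "M \<subseteq> S" "?z \<in> min_reps W S M" "(facial_cover W S)\<^sup>*\<^sup>* F (?z <# parab M)"
    "?z \<otimes> lw M \<preceq> x \<otimes> lw I" "?z \<otimes> lw M \<preceq> y \<otimes> lw J"
    using climb_to_meet[OF assms(1-4) z u(1,2) le] u(3) by auto
  have "?z \<otimes> lw M \<preceq> ?Z"
    using Z(4) M z by simp
  then have "M \<subseteq> K"
    using iff[of "lw M"] below[OF M(1)] wle_min_rep_lw[OF M(1,2)] M(1) by simp
  then have "(facial_cover W S)\<^sup>*\<^sup>* F (?z <# parab K)"
    using facial_up_chain[OF KS min] M(3) rtranclp_trans[of "facial_cover W S"] by blast
  then show "face_le F (?z <# parab K)"
    using facial_iff_face_le F(1) parabolic_cosetI[OF KS z(1)] by blast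
qed

section \<open>Order reversal by the longest element, and joins\<close>

text \<open>Reversal interchanges the two halves of \<open>face_le\<close>.\<close>

lemma face_le_top_mult:
  assumes "F \<subseteq> carrier W" "H \<subseteq> carrier W"
  shows "face_le (lw S <# F) (lw S <# H) \<longleftrightarrow> face_le H F"
proof -
  have "lw S \<otimes> f \<preceq> lw S \<otimes> h \<longleftrightarrow> h \<preceq> f" if "f \<in> F" "h \<in> H" for f h
    using that assms top_mult_wle_iff by blast
  then show ?thesis
    unfolding face_le_def l_coset_def by (simp add: Bex_def Ball_def) blast
qed

text \<open>Reversal exchanges minimum and maximum and keeps the type: a letter of \<open>I\<close>
  shortens the old maximum on the right, hence lengthens its image.\<close>

lemma top_mult_face:
  assumes "I \<subseteq> S" "x \<in> min_reps W S I"
  shows "lw S \<otimes> (x \<otimes> lw I) \<in> min_reps W S I"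
    "lw S \<otimes> (x \<otimes> lw I) \<otimes> lw I = lw S \<otimes> x"
    "lw S <# (x <# parab I) = (lw S \<otimes> (x \<otimes> lw I)) <# parab I"
proof -
  have x: "x \<in> carrier W"
    using assms min_repsD by blast
  have cc: "parab I \<subseteq> carrier W"
    using parab_carrier[OF assms(1)] by blast
  show "lw S \<otimes> (x \<otimes> lw I) \<otimes> lw I = lw S \<otimes> x"
    using x assms by (simp add: m_assoc)
  have "x \<otimes> lw I \<in> x <# parab I"
    using coset_max_mem assms by blast
  then have "x <# parab I = (x \<otimes> lw I) <# parab I"
    using l_repr_independence[of "x \<otimes> lw I" x "parab I"] parab_subgroup[OF assms(1)] x by simp
  then show "lw S <# (x <# parab I) = (lw S \<otimes> (x \<otimes> lw I)) <# parab I"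
    using lcos_m_assoc[OF cc, of "lw S" "x \<otimes> lw I"] x assms by simp
  show "lw S \<otimes> (x \<otimes> lw I) \<in> min_reps W S I"
    unfolding min_reps_def
  proof (intro CollectI conjI ballI)
    fix s assume s: "s \<in> I"
    then have sS: "s \<in> S"
      using assms by auto
    have "len (lw I \<otimes> s) < len (lw I)"
      using len_lw_mult[OF assms(1) parab_incl[OF s]] sS by simp
    then have "len (x \<otimes> (lw I \<otimes> s)) < len (x \<otimes> lw I)"
      using len_min_rep_mult[OF assms] lw_parab[OF assms(1)] parab_mult[OF _ parab_incl[OF s]] by simp
    then show "len (lw S \<otimes> (x \<otimes> lw I)) < len (lw S \<otimes> (x \<otimes> lw I) \<otimes> s)"
      using len_lw_mult[of S "x \<otimes> lw I"] len_lw_mult[of S "x \<otimes> (lw I \<otimes> s)"] x sS assms generate_S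
      by (simp add: m_assoc)
  qed (use x assms in simp)
qed

lemma top_mult_parabolic_coset:
  assumes "F \<in> parabolic_cosets W S"
  shows "lw S <# F \<in> parabolic_cosets W S"
proof -
  obtain x I where F: "I \<subseteq> S" "x \<in> min_reps W S I" "F = x <# parab I"
    by (rule parabolic_cosetE[OF assms])
  then show ?thesis
    using top_mult_face[OF F(1,2)] min_repsD parabolic_cosetI by simp
qed

abbreviation join_type :: "'a \<Rightarrow> 'a set \<Rightarrow> 'a \<Rightarrow> 'a set \<Rightarrow> 'a set" where
  "join_type x I y J \<equiv> left_descents W S (inv ((x \<otimes> lw I) \<or>\<^sub>w (y \<otimes> lw J)) \<otimes> (x \<or>\<^sub>w y))"

text \<open>The meet formula is applied to the reversed faces, whose minima are the reversed maxima.
  Their meet is \<open>lw S \<otimes> z\<close>, and in the quotient defining the type the factor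
  \<open>lw S\<close> cancels, which leaves \<open>K\<close>.\<close>

lemma face_join:
  assumes "I \<subseteq> S" "x \<in> min_reps W S I" "J \<subseteq> S" "y \<in> min_reps W S J"
  defines "z \<equiv> (x \<otimes> lw I) \<or>\<^sub>w (y \<otimes> lw J)" and "K \<equiv> join_type x I y J"
  shows "K \<subseteq> S" "z \<in> carrier W" "\<And>g. g \<in> z <# parab K \<Longrightarrow> g \<in> carrier W \<and> g \<preceq> z"
    "face_le (x <# parab I) (z <# parab K)" "face_le (y <# parab J) (z <# parab K)"
    "\<And>F. F \<in> parabolic_cosets W S \<Longrightarrow> face_le (x <# parab I) F \<Longrightarrow> face_le (y <# parab J) F \<Longrightarrow>
      face_le (z <# parab K) F"
proof -
  let ?x = "lw S \<otimes> (x \<otimes> lw I)" and ?y = "lw S \<otimes> (y \<otimes> lw J)"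
  have c: "x \<in> carrier W" "y \<in> carrier W" "x \<otimes> lw I \<in> carrier W" "y \<otimes> lw J \<in> carrier W"
    using assms min_repsD by auto
  show z: "z \<in> carrier W"
    using wjoin c unfolding z_def by blast
  note tx = top_mult_face[OF assms(1,2)] and ty = top_mult_face[OF assms(3,4)]
  have zeq: "?x \<and>\<^sub>w ?y = lw S \<otimes> z"
    unfolding z_def by (rule top_mult_wjoin[OF c(3,4)])
  have "(?x \<otimes> lw I) \<and>\<^sub>w (?y \<otimes> lw J) = lw S \<otimes> (x \<or>\<^sub>w y)"
    unfolding tx(2) ty(2) by (rule top_mult_wjoin[OF c(1,2)])
  moreover have "inv (lw S \<otimes> z) \<otimes> (lw S \<otimes> (x \<or>\<^sub>w y)) = inv z \<otimes> (x \<or>\<^sub>w y)"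
    using z wjoin(1)[OF c(1,2)] by (simp add: inv_mult_group m_assoc)
  ultimately have Keq: "meet_type ?x I ?y J = K"
    unfolding zeq K_def z_def[symmetric] by simp
  \<comment> \<open>\<open>Keq\<close> is rewritten first, because its left side contains the meet
    that \<open>zeq\<close> replaces.\<close>
  note fm = face_meet[OF assms(1) tx(1) assms(3) ty(1), unfolded Keq, unfolded zeq]
  show KS: "K \<subseteq> S"
    by (rule fm(1))
  have pc: "parab K \<subseteq> carrier W" "z <# parab K \<subseteq> carrier W"
    using parab_carrier[OF KS] z by (auto simp: l_coset_def)
  have coset: "(lw S \<otimes> z) <# parab K = lw S <# (z <# parab K)"
    using lcos_m_assoc[OF pc(1), of "lw S" z] z by simp
  have sub: "x <# parab I \<subseteq> carrier W" "y <# parab J \<subseteq> carrier W"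
    using coset_bounds(1) assms(1-4) by blast+
  show "face_le (x <# parab I) (z <# parab K)" "face_le (y <# parab J) (z <# parab K)"
    using fm(3,4) face_le_top_mult[OF pc(2) sub(1)] face_le_top_mult[OF pc(2) sub(2)]
    unfolding coset tx(3)[symmetric] ty(3)[symmetric] by auto
  show "face_le (z <# parab K) F" if F: "F \<in> parabolic_cosets W S" "face_le (x <# parab I) F"
    "face_le (y <# parab J) F" for F
  proof -
    have Fc: "F \<subseteq> carrier W"
      using F parabolic_coset_carrier by blast
    have "face_le (lw S <# F) (lw S <# (z <# parab K))"
      unfolding coset[symmetric]
      using F top_mult_parabolic_coset[OF F(1)] face_le_top_mult[OF Fc sub(1)] face_le_top_mult[OF Fc sub(2)]
      by (intro fm(5)) (simp_all flip: tx(3) ty(3))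
    then show ?thesis
      using face_le_top_mult[OF Fc pc(2)] by blast
  qed
  \<comment> \<open>The reversed coset has minimum \<open>lw S \<otimes> z\<close>; reversing back
    turns this into a maximum.\<close>
  show "g \<in> carrier W \<and> g \<preceq> z" if g: "g \<in> z <# parab K" for g
  proof -
    have gc: "g \<in> carrier W"
      using g pc by blast
    have "lw S \<otimes> g \<in> (lw S \<otimes> z) <# parab K"
      unfolding coset using g by (auto simp: l_coset_def)
    then show ?thesis
      using coset_bounds(2)[OF KS fm(2)] top_mult_wle_iff[OF z gc] gc by blast
  qed
qed

lemma facial_glb:
  assumes "I \<subseteq> S" "x \<in> min_reps W S I" "J \<subseteq> S" "y \<in> min_reps W S J"
  shows "greatest (facial_weak_order W S) ((x \<and>\<^sub>w y) <# parab (meet_type x I y J))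
    (Lower (facial_weak_order W S) {x <# parab I, y <# parab J})"
proof -
  have c: "x <# parab I \<in> parabolic_cosets W S" "y <# parab J \<in> parabolic_cosets W S"
    "(x \<and>\<^sub>w y) <# parab (meet_type x I y J) \<in> parabolic_cosets W S"
    using parabolic_cosetI min_repsD assms face_meet(1,2)[OF assms] by blast+
  show ?thesis
    using face_meet(3-5)[OF assms] c by (auto simp: greatest_def Lower_def)
qed

lemma facial_lub:
  assumes "I \<subseteq> S" "x \<in> min_reps W S I" "J \<subseteq> S" "y \<in> min_reps W S J"
  shows "least (facial_weak_order W S) (((x \<otimes> lw I) \<or>\<^sub>w (y \<otimes> lw J)) <# parab (join_type x I y J))
    (Upper (facial_weak_order W S) {x <# parab I, y <# parab J})"
proof -
  have c: "x <# parab I \<in> parabolic_cosets W S" "y <# parab J \<in> parabolic_cosets W S"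
    "((x \<otimes> lw I) \<or>\<^sub>w (y \<otimes> lw J)) <# parab (join_type x I y J) \<in> parabolic_cosets W S"
    using parabolic_cosetI min_repsD assms face_join(1,2)[OF assms] by blast+
  show ?thesis
    using face_join(4-6)[OF assms] c by (auto simp: least_def Upper_def)
qed

lemma facial_lattice: "lattice (facial_weak_order W S)"
proof -
  interpret partial_order "facial_weak_order W S"
    by (rule facial_partial_order)
  show ?thesis
  proof
    fix F H
    assume "F \<in> carrier (facial_weak_order W S)" "H \<in> carrier (facial_weak_order W S)"
    then obtain x I y J where "I \<subseteq> S" "x \<in> min_reps W S I" "F = x <# parab I"
      "J \<subseteq> S" "y \<in> min_reps W S J" "H = y <# parab J"
      using parabolic_cosetE[of F] parabolic_cosetE[of H] by (metis facial_weak_order_simps(1))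
    then show "\<exists>s. least (facial_weak_order W S) s (Upper (facial_weak_order W S) {F, H})"
      "\<exists>s. greatest (facial_weak_order W S) s (Lower (facial_weak_order W S) {F, H})"
      using facial_lub facial_glb by blast+
  qed
qed

end

theorem theorem3p19:
  fixes W :: "('a, 'b) monoid_scheme" and S :: "'a set"
  assumes "coxeter_system W S" and "finite (carrier W)"
  shows "lattice (facial_weak_order W S) \<and>
    (\<forall>I J x y. I \<subseteq> S \<longrightarrow> J \<subseteq> S \<longrightarrow> x \<in> min_reps W S I \<longrightarrow> y \<in> min_reps W S J \<longrightarrow>
      (let X = x \<otimes>\<^bsub>W\<^esub> longest_elem W S I;
           Y = y \<otimes>\<^bsub>W\<^esub> longest_elem W S J;
           zm = x \<sqinter>\<^bsub>weak_order W S\<^esub> y;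
           Km = left_descents W S (inv\<^bsub>W\<^esub> zm \<otimes>\<^bsub>W\<^esub> (X \<sqinter>\<^bsub>weak_order W S\<^esub> Y));
           zj = X \<squnion>\<^bsub>weak_order W S\<^esub> Y;
           Kj = left_descents W S (inv\<^bsub>W\<^esub> zj \<otimes>\<^bsub>W\<^esub> (x \<squnion>\<^bsub>weak_order W S\<^esub> y))
       in (x <#\<^bsub>W\<^esub> generate W I) \<sqinter>\<^bsub>facial_weak_order W S\<^esub> (y <#\<^bsub>W\<^esub> generate W J)
            = zm <#\<^bsub>W\<^esub> generate W Km \<and>
          zm \<in> min_reps W S Km \<and>
          (x <#\<^bsub>W\<^esub> generate W I) \<squnion>\<^bsub>facial_weak_order W S\<^esub> (y <#\<^bsub>W\<^esub> generate W J)
            = zj <#\<^bsub>W\<^esub> generate W Kj \<and>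
          greatest (weak_order W S) zj (zj <#\<^bsub>W\<^esub> generate W Kj)))"
proof -
  obtain m where "group W" "S \<subseteq> carrier W" "generate W S = carrier W" "coxeter_matrix S m"
    "\<And>us vs. set us \<subseteq> S \<Longrightarrow> set vs \<subseteq> S \<Longrightarrow>
      word_prod W us = word_prod W vs \<longleftrightarrow> coxeter_cong S m us vs"
    using assms(1) unfolding coxeter_system_def by blast
  then interpret finite_coxeter W S m
    using assms(2)
    by (simp add: finite_coxeter_def finite_coxeter_axioms_def coxeter_def coxeter_axioms_def)
  interpret facial: partial_order "facial_weak_order W S"
    by (rule facial_partial_order)
  show ?thesis
    unfolding Let_def
  proof (intro conjI allI impI)
    show "lattice (facial_weak_order W S)"
      by (rule facial_lattice)
    fix I J x y
    assume *: "I \<subseteq> S" "J \<subseteq> S" "x \<in> min_reps W S I" "y \<in> min_reps W S J"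
    note a = *(1,3,2,4)
    show "(x <#\<^bsub>W\<^esub> parab I) \<sqinter>\<^bsub>facial_weak_order W S\<^esub> (y <#\<^bsub>W\<^esub> parab J)
        = (x \<and>\<^sub>w y) <#\<^bsub>W\<^esub> parab (meet_type x I y J)"
      by (rule facial.meet_equality[OF facial_glb[OF a]])
    show "x \<and>\<^sub>w y \<in> min_reps W S (meet_type x I y J)"
      by (rule face_meet(2)[OF a])
    let ?z = "(x \<otimes>\<^bsub>W\<^esub> lw I) \<or>\<^sub>w (y \<otimes>\<^bsub>W\<^esub> lw J)"
    show "(x <#\<^bsub>W\<^esub> parab I) \<squnion>\<^bsub>facial_weak_order W S\<^esub> (y <#\<^bsub>W\<^esub> parab J)
        = ?z <#\<^bsub>W\<^esub> parab (join_type x I y J)"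
      by (rule facial.join_equality[OF facial_lub[OF a]])
    show "greatest (weak_order W S) ?z (?z <#\<^bsub>W\<^esub> parab (join_type x I y J))"
      \<comment> \<open>\<open>coset_min_mem\<close> only supplies that a representative lies in its
        coset; here the representative \<open>?z\<close> is the maximum.\<close>
      using face_join(1-3)[OF a] coset_min_mem[of ?z] by (auto simp: greatest_def)
  qed
qed

end
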